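(* Let $\mathcal{D}=\mathcal{D}^1\times\mathcal{D}^2$ be any product dyadic grid in $\mathbb{R}^n\times\mathbb{R}^m$. Let $1<p<\infty$, and let $W$ be a $d\times d$-matrix valued $\mathcal{D}$-dyadic biparameter $A_p$ weight on $\mathbb{R}^n\times\mathbb{R}^m$. Let $$S_{\mathcal{D},W}f(x):=\Big(\sum_{R\in\mathcal{D}}\sum_{\varepsilon\in\mathcal{E}}|W(x)^{1/p}f_R^{\varepsilon}|^2\frac{\mathbf{1}_R(x)}{|R|}\Big)^{1/2},\qquad \widetilde S_{\mathcal{D},W}f(x):=\Big(\sum_{R\in\mathcal{D}}\sum_{\varepsilon\in\mathcal{E}}|\mathcal{W}_Rf_R^{\varepsilon}|^2\frac{\mathbf{1}_R(x)}{|R|}\Big)^{1/2},$$ where $\mathcal{W}_R$ is the reducing operator of $W$ over $R$ with respect to the exponent $p$. Then $$\|\widetilde S_{\mathcal{D},W}f\|_{L^p}\lesssim_{d,p,n,m}[W]_{A_p,\mathcal{D}}^{1/p}\|S_{\mathcal{D},W}f\|_{L^p}\qquad\text{for all } f\in L^1_{\mathrm{loc}}(\mathbb{R}^{n+m};\mathbb{C}^d).$$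
   Context: $x\lesssim_{a,b}y$ means $x\le cy$ with a finite constant $c$ depending only on $a,b$. $p'=p/(p-1)$. A dyadic grid in $\mathbb{R}$ is a collection $\bigcup_{k\in\mathbb{Z}}\mathcal{D}_k$ of left-closed right-open intervals, where each $\mathcal{D}_k$ partitions $\mathbb{R}$ into intervals of length $2^{-k}$ and each interval of $\mathcal{D}_k$ is the union of exactly two intervals of $\mathcal{D}_{k+1}$. A dyadic grid in $\mathbb{R}^n$ is the family of cubes $I_1\times\dots\times I_n$ with $I_i$ in the $i$-th of $n$ given dyadic grids in $\mathbb{R}$, all of the same length. $\mathcal{D}=\mathcal{D}^1\times\mathcal{D}^2$ is the family of rectangles $R_1\times R_2$, $R_i\in\mathcal{D}^i$. Haar functions: for an interval $I$ with right/left halves $I_\pm$, $h_I^0:=(\mathbf{1}_{I_+}-\mathbf{1}_{I_-})/\sqrt{|I|}$, $h_I^1:=\mathbf{1}_I/\sqrt{|I|}$; for a cube $Q=I_1\times\dots\times I_n$ and $\varepsilon\in\{0,1\}^n$, $h_Q^\varepsilon:=h_{I_1}^{\varepsilon_1}\otimes\dots\otimes h_{I_n}^{\varepsilon_n}$. $\mathcal{E}:=\mathcal{E}^1\times\mathcal{E}^2$ with $\mathcal{E}^1=\{0,1\}^n\setminus\{(1,\dots,1)\}$, $\mathcal{E}^2=\{0,1\}^m\setminus\{(1,\dots,1)\}$; $h_R^\varepsilon:=h_{R_1}^{\varepsilon_1}\otimes h_{R_2}^{\varepsilon_2}$ and $f_R^\varepsilon:=\int f h_R^\varepsilon$. A $d\times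 d$-matrix valued weight is a locally integrable $M_d(\mathbb{C})$-valued function, positive definite a.e. $[W]_{A_p,\mathcal{D}}:=\sup_{R\in\mathcal{D}}\frac1{|R|}\int_R\big(\frac1{|R|}\int_R|W(x)^{1/p}W(y)^{-1/p}|^{p'}dy\big)^{p/p'}dx$; $W$ is a $\mathcal{D}$-dyadic biparameter $A_p$ weight if this is finite. Reducing operator: a positive definite matrix $\mathcal{W}_E$ with $\big(\frac1{|E|}\int_E|W^{1/p}e|^p\big)^{1/p}\le|\mathcal{W}_Ee|\le\sqrt d\big(\frac1{|E|}\int_E|W^{1/p}e|^p\big)^{1/p}$ for all $e\in\mathbb{C}^d$ (such matrices exist; any fixed choice is allowed). *)

theory Defs
  imports "HOL-Analysis.Analysis"
begin

section \<open>Dyadic grids\<close>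

definition dyadic_grid :: "real set set \<Rightarrow> bool" where
  "dyadic_grid G \<longleftrightarrow>
     (\<exists>D :: int \<Rightarrow> real set set.
        G = (\<Union>k. D k) \<and>
        (\<forall>k. partition_on UNIV (D k)) \<and>
        (\<forall>k. \<forall>I\<in>D k. \<exists>a. I = {a..<a + 2 powi (- k)}) \<and>
        (\<forall>k. \<forall>I\<in>D k. \<exists>J\<in>D (k + 1). \<exists>J'\<in>D (k + 1). J \<noteq> J' \<and> I = J \<union> J'))"

definition cube_grid :: "('n \<Rightarrow> real set set) \<Rightarrow> (real^'n) set set" where
  "cube_grid G =
     {{x. \<forall>i. x $ i \<in> I i} | I.
        (\<forall>i. I i \<in> G i) \<and> (\<forall>i j. measure lebesgue (I i) = measure lebesgue (I j))}"

definition dyadic_cube_grid :: "(real^'n) set set \<Rightarrow> bool" where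
  "dyadic_cube_grid \<D> \<longleftrightarrow> (\<exists>G. (\<forall>i. dyadic_grid (G i)) \<and> \<D> = cube_grid G)"

definition product_grid :: "'a set set \<Rightarrow> 'b set set \<Rightarrow> ('a \<times> 'b) set set" where
  "product_grid \<D>1 \<D>2 = {R1 \<times> R2 | R1 R2. R1 \<in> \<D>1 \<and> R2 \<in> \<D>2}"


section \<open>Haar functions\<close>

text \<open>The halves of a nonempty bounded interval that is closed on the left and open on the right.\<close>

definition left_half :: "real set \<Rightarrow> real set" where
  "left_half I = {Inf I..<(Inf I + Sup I) / 2}"

definition right_half :: "real set \<Rightarrow> real set" where
  "right_half I = {(Inf I + Sup I) / 2..<Sup I}"

definition haar_interval :: "real set \<Rightarrow> nat \<Rightarrow> real \<Rightarrow> real" where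
  "haar_interval I e t =
     (if e = 0 then indicator (right_half I) t - indicator (left_half I) t else indicator I t)
       / sqrt (measure lebesgue I)"

text \<open>The edges of a nonempty box are its coordinate projections.\<close>

definition haar_cube :: "(real^'n::finite) set \<Rightarrow> ('n \<Rightarrow> nat) \<Rightarrow> real^'n \<Rightarrow> real" where
  "haar_cube Q \<epsilon> x = (\<Prod>i\<in>UNIV. haar_interval ((\<lambda>y. y $ i) ` Q) (\<epsilon> i) (x $ i))"

definition haar_rectangle ::
  "((real^'n::finite) \<times> (real^'m::finite)) set \<Rightarrow> ('n \<Rightarrow> nat) \<times> ('m \<Rightarrow> nat) \<Rightarrow> (real^'n) \<times> (real^'m) \<Rightarrow> real" where
  "haar_rectangle R \<epsilon> x =
     haar_cube (fst ` R) (fst \<epsilon>) (fst x) * haar_cube (snd ` R) (snd \<epsilon>) (snd x)"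

definition signatures :: "('n \<Rightarrow> nat) set" where
  "signatures = {\<epsilon>. \<forall>i. \<epsilon> i \<in> {0, 1}} - {\<lambda>i. 1}"

definition haar_coeff ::
  "((real^'n::finite) \<times> (real^'m::finite) \<Rightarrow> complex^'d::finite) \<Rightarrow> ((real^'n) \<times> (real^'m)) set
     \<Rightarrow> ('n \<Rightarrow> nat) \<times> ('m \<Rightarrow> nat) \<Rightarrow> complex^'d" where
  "haar_coeff f R \<epsilon> = (LINT x|lebesgue. haar_rectangle R \<epsilon> x *\<^sub>R f x)"


section \<open>Positive definite matrices and their real powers\<close>

definition conj_transpose :: "complex^'d^'d \<Rightarrow> complex^'d^'d" where
  "conj_transpose A = (\<chi> i j. cnj (A $ j $ i))"

definition positive_definite :: "complex^'d^'d::finite \<Rightarrow> bool" where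
  "positive_definite A \<longleftrightarrow>
     conj_transpose A = A \<and>
     (\<forall>e. e \<noteq> 0 \<longrightarrow> 0 < Re (\<Sum>i\<in>UNIV. (A *v e) $ i * cnj (e $ i)))"

definition diag_matrix :: "('d \<Rightarrow> real) \<Rightarrow> complex^'d^'d" where
  "diag_matrix \<mu> = (\<chi> i j. if i = j then complex_of_real (\<mu> i) else 0)"

text \<open>The power of a positive definite matrix, by unitary diagonalisation; the result does not
  depend on the diagonalisation. The value at a matrix that is not positive definite is irrelevant.\<close>

definition matrix_powr :: "complex^'d^'d::finite \<Rightarrow> real \<Rightarrow> complex^'d^'d" where
  "matrix_powr A s =
     (THE B. \<exists>U \<mu>. U ** conj_transpose U = mat 1 \<and> conj_transpose U ** U = mat 1 \<and>
        (\<forall>i. 0 < \<mu> i) \<and>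
        A = U ** diag_matrix \<mu> ** conj_transpose U \<and>
        B = U ** diag_matrix (\<lambda>i. \<mu> i powr s) ** conj_transpose U)"

definition matrix_norm :: "complex^'d^'d::finite \<Rightarrow> real" where
  "matrix_norm A = onorm (\<lambda>e. A *v e)"


section \<open>Integrals with values in the extended half line\<close>

text \<open>Only used with positive exponents.\<close>

definition ennreal_powr :: "ennreal \<Rightarrow> real \<Rightarrow> ennreal" where
  "ennreal_powr x s = (if x = \<infinity> then \<infinity> else ennreal (enn2real x powr s))"

definition average :: "'a::euclidean_space set \<Rightarrow> ('a \<Rightarrow> ennreal) \<Rightarrow> ennreal" where
  "average E g = (\<integral>\<^sup>+x\<in>E. g x \<partial>lebesgue) / emeasure lebesgue E"

definition Lp_norm :: "real \<Rightarrow> ('a::euclidean_space \<Rightarrow> ennreal) \<Rightarrow> ennreal" where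
  "Lp_norm p g = ennreal_powr (\<integral>\<^sup>+x. ennreal_powr (g x) p \<partial>lebesgue) (1 / p)"

definition locally_integrable ::
  "('a::euclidean_space \<Rightarrow> 'b::euclidean_space) \<Rightarrow> bool" where
  "locally_integrable f \<longleftrightarrow> (\<forall>K. compact K \<longrightarrow> set_integrable lebesgue K f)"


section \<open>Matrix weights\<close>

definition matrix_weight :: "('a::euclidean_space \<Rightarrow> complex^'d^'d::finite) \<Rightarrow> bool" where
  "matrix_weight W \<longleftrightarrow> locally_integrable W \<and> (AE x in lebesgue. positive_definite (W x))"

definition conj_exponent :: "real \<Rightarrow> real" where
  "conj_exponent p = p / (p - 1)"

definition Ap_constant ::
  "real \<Rightarrow> 'a::euclidean_space set set \<Rightarrow> ('a \<Rightarrow> complex^'d^'d::finite) \<Rightarrow> ennreal" where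
  "Ap_constant p \<D> W =
     (SUP R\<in>\<D>. average R (\<lambda>x.
        ennreal_powr
          (average R (\<lambda>y.
             ennreal (matrix_norm (matrix_powr (W x) (1 / p) ** matrix_powr (W y) (- 1 / p))
               powr conj_exponent p)))
          (p / conj_exponent p)))"

definition Ap_weight ::
  "real \<Rightarrow> 'a::euclidean_space set set \<Rightarrow> ('a \<Rightarrow> complex^'d^'d::finite) \<Rightarrow> bool" where
  "Ap_weight p \<D> W \<longleftrightarrow> matrix_weight W \<and> Ap_constant p \<D> W < \<infinity>"

definition reducing_operator ::
  "real \<Rightarrow> ('a::euclidean_space \<Rightarrow> complex^'d^'d::finite) \<Rightarrow> 'a set \<Rightarrow> complex^'d^'d \<Rightarrow> bool" where
  "reducing_operator p W E A \<longleftrightarrow>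
     positive_definite A \<and>
     (\<forall>e. let N = ennreal_powr
                 (average E (\<lambda>x. ennreal (norm (matrix_powr (W x) (1 / p) *v e) powr p))) (1 / p)
          in N \<le> ennreal (norm (A *v e)) \<and>
             ennreal (norm (A *v e)) \<le> ennreal (sqrt (real CARD('d))) * N)"


section \<open>Square functions\<close>

text \<open>The common form of both square functions: \<^term>\<open>A R x\<close> is the matrix applied to the Haar
  coefficients over the rectangle \<^term>\<open>R\<close> at the point \<^term>\<open>x\<close>.\<close>

definition square_function ::
  "(((real^'n::finite) \<times> (real^'m::finite)) set \<Rightarrow> (real^'n) \<times> (real^'m) \<Rightarrow> complex^'d^'d::finite)
     \<Rightarrow> ((real^'n) \<times> (real^'m)) set set \<Rightarrow> ((real^'n) \<times> (real^'m) \<Rightarrow> complex^'d)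
     \<Rightarrow> (real^'n) \<times> (real^'m) \<Rightarrow> ennreal" where
  "square_function A \<D> f x =
     ennreal_powr
       (\<Sum>\<^sub>\<infinity>R\<in>\<D>. \<Sum>\<epsilon>\<in>signatures \<times> signatures.
          ennreal ((norm (A R x *v haar_coeff f R \<epsilon>))\<^sup>2 * indicator R x / measure lebesgue R))
       (1 / 2)"

definition weighted_square_function ::
  "real \<Rightarrow> ((real^'n::finite) \<times> (real^'m::finite)) set set
     \<Rightarrow> ((real^'n) \<times> (real^'m) \<Rightarrow> complex^'d^'d::finite) \<Rightarrow> ((real^'n) \<times> (real^'m) \<Rightarrow> complex^'d)
     \<Rightarrow> (real^'n) \<times> (real^'m) \<Rightarrow> ennreal" where
  "weighted_square_function p \<D> W = square_function (\<lambda>R x. matrix_powr (W x) (1 / p)) \<D>"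

definition reduced_square_function ::
  "((real^'n::finite) \<times> (real^'m::finite)) set set
     \<Rightarrow> (((real^'n) \<times> (real^'m)) set \<Rightarrow> complex^'d^'d::finite) \<Rightarrow> ((real^'n) \<times> (real^'m) \<Rightarrow> complex^'d)
     \<Rightarrow> (real^'n) \<times> (real^'m) \<Rightarrow> ennreal" where
  "reduced_square_function \<D> \<W> = square_function (\<lambda>R x. \<W> R) \<D>"

end

theory Submission
  imports Defs
begin

text \<open>
  Fix a rectangle \<open>R\<close> and a vector \<open>e\<close>, and put \<open>v(y) = |W(y)\<^bsup>1/p\<^esup> e|\<close>. Since
  \<open>v(x) \<le> |W(x)\<^bsup>1/p\<^esup> W(y)\<^bsup>-1/p\<^esup>| v(y)\<close>, the \<open>A\<^sub>p\<close> condition bounds by \<open>[W]\<close> the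
  product of the \<open>p\<close>-th moment of \<open>v\<close> over \<open>R\<close>, which is comparable to \<open>|\<W>\<^sub>R e|\<^sup>p\<close>, and a power of a negative moment
  (\<open>reducing_operator_negative_moment\<close>). By Markov's inequality for that negative moment,
  \<open>|\<W>\<^sub>R e| \<le> K v(y)\<close> for all \<open>y\<close> in a subset \<open>E\<close> of \<open>R\<close> with at least half of its measure, where \<open>K\<close> is a
  constant depending on \<open>d\<close> and \<open>p\<close> times \<open>[W]\<^bsup>1/p\<^esup>\<close> (\<open>reducing_operator_le_on_large_set\<close>).

  With \<open>e\<close> the Haar coefficients and \<open>b\<close> the numbers \<open>|\<W>\<^sub>R e|\<^sup>2 / |R|\<close>, the square of the left-hand square
  function is \<open>\<Sum> b 1\<^sub>R\<close>, and \<open>\<Sum> b 1\<^sub>E\<close> is at most \<open>K\<^sup>2\<close> times the square of the right-hand one. It remains to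
  compare the two sums in \<open>L\<^bsup>p/2\<^esup>\<close>: shrinking rectangles to large subsets costs only a constant
  (\<open>shrink_rectangles\<close>). For \<open>p > 2\<close> this follows by duality from the boundedness of the strong dyadic
  maximal function. For \<open>p \<le> 2\<close> the dual weight is a negative power of the maximal function
  of a small power of \<open>\<Sum> b 1\<^sub>E\<close>, and Jensen's inequality for that negative power replaces duality. In neither case is
  a vector-valued maximal inequality involved.

  The strong dyadic maximal function is dominated by the composition of two dyadic maximal functions,
  and these are bounded on \<open>L\<^sup>q\<close> by Doob's argument: a weak type inequality on level sets, integrated over
  the levels. Everything is done for finite families, so that the quantities to be absorbed are finite;
  monotone convergence gives the full sum. Finally, measurability of \<open>v\<close> requires a formula for
  the powers of a positive definite matrix that is measurable in its entries; the binomial series provides one.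
\<close>

section \<open>Powers of positive definite matrices\<close>

definition herm :: "complex^'d::finite \<Rightarrow> complex^'d \<Rightarrow> complex" where
  "herm x y = (\<Sum>i\<in>UNIV. x $ i * cnj (y $ i))"

lemma herm_diff_left: "herm (x - y) z = herm x z - herm y z"
  by (simp add: herm_def algebra_simps sum_subtractf)

lemma herm_add_left: "herm (x + y) z = herm x z + herm y z"
  by (simp add: herm_def algebra_simps sum.distrib)

lemma herm_scale_left: "herm (c *s x) z = c * herm x z"
  by (simp add: herm_def algebra_simps sum_distrib_left)

lemma herm_scaleR_left: "herm (c *\<^sub>R x) z = of_real c * herm x z"
  by (simp add: herm_def algebra_simps sum_distrib_left scaleR_conv_of_real[where 'a=complex])

lemma herm_zero_left [simp]: "herm 0 z = 0"
  by (simp add: herm_def)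

lemma herm_sum_left: "herm (sum g S) z = (\<Sum>s\<in>S. herm (g s) z)"
  by (induction S rule: infinite_finite_induct) (simp_all add: herm_add_left)

lemma herm_commute: "herm y x = cnj (herm x y)"
  by (simp add: herm_def mult.commute)

lemma inner_eq_Re_herm: "x \<bullet> y = Re (herm x y)"
  by (simp add: herm_def inner_vec_def inner_complex_def)

lemma herm_self: "herm x x = of_real ((norm x)\<^sup>2)"
proof -
  have "herm x x = of_real (Re (herm x x))"
    by (simp add: herm_def complex_eq_iff)
  also have "Re (herm x x) = (norm x)\<^sup>2"
    by (simp add: inner_eq_Re_herm[symmetric] power2_norm_eq_inner)
  finally show ?thesis .
qed

lemma herm_adjoint: "herm (A *v x) y = herm x (conj_transpose A *v y)"
proof -
  have "herm (A *v x) y = (\<Sum>i\<in>UNIV. \<Sum>j\<in>UNIV. A $ i $ j * x $ j * cnj (y $ i))"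
    by (simp add: herm_def matrix_vector_mult_def sum_distrib_right)
  also have "\<dots> = (\<Sum>j\<in>UNIV. \<Sum>i\<in>UNIV. A $ i $ j * x $ j * cnj (y $ i))"
    by (rule sum.swap)
  also have "\<dots> = herm x (conj_transpose A *v y)"
    by (simp add: herm_def matrix_vector_mult_def sum_distrib_left conj_transpose_def algebra_simps)
  finally show ?thesis .
qed

text \<open>Orthonormal refers to the complex inner product \<open>herm\<close>. Orthogonality for the real inner product of
  the type class, which is its real part, would be too weak for unitary matrices.\<close>

definition orthonormal_set :: "(complex^'d::finite) set \<Rightarrow> bool" where
  "orthonormal_set S \<longleftrightarrow> (\<forall>s\<in>S. \<forall>t\<in>S. herm s t = (if s = t then 1 else 0))"

text \<open>Too few vectors do not span; subtracting from a vector outside the span its orthogonal projection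
  leaves a nonzero vector in the orthogonal complement.\<close>

lemma exists_orthogonal_vector:
  fixes S :: "(complex^'d::finite) set"
  assumes "finite S" "card S < CARD('d)" "orthonormal_set S"
  shows "\<exists>x. x \<noteq> 0 \<and> (\<forall>s\<in>S. herm x s = 0)"
proof -
  have "vec.span S \<noteq> UNIV"
  proof
    assume "vec.span S = UNIV"
    then have "vec.dim (UNIV :: (complex^'d) set) \<le> card S"
      using vec.dim_le_card[of UNIV S] assms(1) by simp
    then show False using assms(2) vec_dim_card[where 'a=complex and 'n='d] by linarith
  qed
  then obtain x where x: "x \<notin> vec.span S" by blast
  define y where "y = x - (\<Sum>s\<in>S. herm x s *s s)"
  have "(\<Sum>s\<in>S. herm x s *s s) \<in> vec.span S"
    by (intro vec.span_sum vec.span_scale vec.span_base)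
  then have "y \<noteq> 0" using x by (auto simp: y_def)
  moreover have "herm y s = 0" if "s \<in> S" for s
  proof -
    have "herm y s = herm x s - (\<Sum>t\<in>S. herm x t * herm t s)"
      by (simp add: y_def herm_diff_left herm_sum_left herm_scale_left)
    also have "(\<Sum>t\<in>S. herm x t * herm t s) = (\<Sum>t\<in>S. if t = s then herm x t else 0)"
      using assms(3) that by (intro sum.cong) (auto simp: orthonormal_set_def)
    also have "\<dots> = herm x s" using that assms(1) by simp
    finally show ?thesis by simp
  qed
  ultimately show ?thesis by blast
qed

text \<open>A maximiser of the Rayleigh quotient on the unit sphere of the subspace is an eigenvector. Real
  subspaces and the real inner product suffice for the variational argument.\<close>

lemma hermitian_eigenvector_in_invariant_subspace:
  fixes A :: "complex^'d^'d::finite"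
  assumes A: "conj_transpose A = A"
    and V: "subspace V" "\<And>x. x \<in> V \<Longrightarrow> A *v x \<in> V" and z: "z \<in> V" "z \<noteq> 0"
  shows "\<exists>x\<in>V. norm x = 1 \<and> (\<exists>\<mu>::real. A *v x = \<mu> *\<^sub>R x)"
proof -
  have sym: "(A *v x) \<bullet> y = x \<bullet> (A *v y)" for x y
    by (simp add: inner_eq_Re_herm herm_adjoint A)
  define K where "K = V \<inter> sphere 0 1"
  have "compact K"
    unfolding K_def using V(1) by (intro closed_Int_compact closed_subspace compact_sphere)
  moreover have "(1 / norm z) *\<^sub>R z \<in> K"
    using z V(1) by (simp add: K_def subspace_scale)
  moreover have "continuous_on K (\<lambda>x. (A *v x) \<bullet> x)"
    by (intro continuous_on_inner linear_continuous_on continuous_on_id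
        matrix_vector_mul_bounded_linear)
  ultimately obtain x where x: "x \<in> K" and max: "\<And>y. y \<in> K \<Longrightarrow> (A *v y) \<bullet> y \<le> (A *v x) \<bullet> x"
    using continuous_attains_sup[of K "\<lambda>x. (A *v x) \<bullet> x"] by blast
  define \<mu> where "\<mu> = (A *v x) \<bullet> x"
  have xV: "x \<in> V" and nx: "norm x = 1" using x by (auto simp: K_def)
  have bound: "(A *v y) \<bullet> y \<le> \<mu> * (y \<bullet> y)" if "y \<in> V" for y
  proof (cases "y = 0")
    case False
    have "(1 / norm y) *\<^sub>R y \<in> K"
      using False that V(1) by (simp add: K_def subspace_scale)
    moreover have "A *v ((1 / norm y) *\<^sub>R y) = (1 / norm y) *\<^sub>R (A *v y)"
      by (rule linear_scale) simp
    ultimately have "((A *v y) \<bullet> y) / (norm y)\<^sup>2 \<le> \<mu>"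
      using max[of "(1 / norm y) *\<^sub>R y"] by (simp add: \<mu>_def power2_eq_square)
    then show ?thesis
      using False by (simp add: divide_simps power2_norm_eq_inner[symmetric] split: if_splits)
  qed simp
  define w where "w = A *v x - \<mu> *\<^sub>R x"
  have wV: "w \<in> V" unfolding w_def using V xV by (intro subspace_diff subspace_scale) auto
  \<comment> \<open>The Rayleigh quotient is stationary at \<open>x\<close>, so its derivative in the direction \<open>w\<close> vanishes.\<close>
  have quad: "2 * t * (w \<bullet> w) \<le> t\<^sup>2 * (\<mu> * (w \<bullet> w) - (A *v w) \<bullet> w)" for t :: real
  proof -
    have "x + t *\<^sub>R w \<in> V" using V(1) xV wV by (intro subspace_add subspace_scale)
    from bound[OF this]
    have "(A *v x) \<bullet> x + 2 * t * ((A *v x) \<bullet> w) + t\<^sup>2 * ((A *v w) \<bullet> w)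
        \<le> \<mu> * (x \<bullet> x + 2 * t * (x \<bullet> w) + t\<^sup>2 * (w \<bullet> w))"
      using sym[of w x] linear_scale[of "(*v) A" t w]
      by (simp add: algebra_simps matrix_vector_right_distrib
          inner_add_left inner_add_right inner_commute power2_eq_square)
    moreover have "x \<bullet> x = 1" using nx by (simp add: power2_norm_eq_inner[symmetric])
    moreover have "w \<bullet> w = (A *v x) \<bullet> w - \<mu> * (x \<bullet> w)"
      by (simp add: w_def inner_diff_left)
    ultimately have "\<mu> + 2 * t * ((A *v x) \<bullet> w) + t\<^sup>2 * ((A *v w) \<bullet> w)
        \<le> \<mu> * (1 + 2 * t * (x \<bullet> w) + t\<^sup>2 * (w \<bullet> w))"
      and "2 * t * (w \<bullet> w) = 2 * t * ((A *v x) \<bullet> w) - 2 * t * (\<mu> * (x \<bullet> w))"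
      by (simp_all only: \<mu>_def[symmetric] right_diff_distrib)
    then show ?thesis by (simp add: algebra_simps)
  qed
  have "w \<bullet> w \<le> 0"
  proof (rule ccontr)
    assume "\<not> w \<bullet> w \<le> 0"
    define a where "a = w \<bullet> w"
    define c where "c = \<mu> * (w \<bullet> w) - (A *v w) \<bullet> w"
    have a: "a > 0" using \<open>\<not> w \<bullet> w \<le> 0\<close> unfolding a_def by linarith
    have q: "2 * t * a \<le> t\<^sup>2 * c" for t using quad[of t] by (simp add: a_def c_def)
    \<comment> \<open>So small a step makes the quadratic term in \<open>q\<close> smaller than the linear one.\<close>
    define t where "t = a / (\<bar>c\<bar> + 1)"
    have t: "t > 0" using a by (simp add: t_def)
    have "2 * a \<le> t * c" using q[of t] t by (simp add: power2_eq_square)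
    also have "\<dots> \<le> t * (\<bar>c\<bar> + 1)" using t by (intro mult_left_mono) auto
    also have "\<dots> = a" by (simp add: t_def)
    finally show False using a by simp
  qed
  then have "w = 0" using inner_gt_zero_iff[of w] by linarith
  then show ?thesis using xV nx by (auto simp: w_def)
qed

text \<open>The spectral theorem, one eigenvector at a time: the orthogonal complement of the eigenvectors
  already found is invariant because the matrix is Hermitian.\<close>

lemma hermitian_orthonormal_eigenvectors:
  fixes A :: "complex^'d^'d::finite"
  assumes A: "conj_transpose A = A" and "k \<le> CARD('d)"
  shows "\<exists>S. finite S \<and> card S = k \<and> orthonormal_set S \<and> (\<forall>s\<in>S. \<exists>\<mu>::real. A *v s = \<mu> *\<^sub>R s)"
  using assms(2)
proof (induction k)
  case 0
  show ?case by (intro exI[of _ "{}"]) (simp add: orthonormal_set_def)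
next
  case (Suc k)
  then obtain S where S: "finite S" "card S = k" "orthonormal_set S"
    "\<And>s. s \<in> S \<Longrightarrow> \<exists>\<mu>::real. A *v s = \<mu> *\<^sub>R s" by auto
  define V where "V = {x. \<forall>s\<in>S. herm x s = 0}"
  obtain z where z: "z \<in> V" "z \<noteq> 0"
    using exists_orthogonal_vector[of S] S Suc.prems by (auto simp: V_def)
  have "subspace V"
    by (auto simp: subspace_def V_def herm_add_left herm_scaleR_left)
  moreover have "A *v x \<in> V" if "x \<in> V" for x
  proof -
    have "herm (A *v x) s = 0" if s: "s \<in> S" for s
    proof -
      obtain \<mu> :: real where "A *v s = \<mu> *\<^sub>R s" using S(4)[OF s] by blast
      then have "herm (A *v x) s = cnj (herm (\<mu> *\<^sub>R s) x)"
        by (simp add: herm_adjoint A herm_commute[of x])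
      also have "\<dots> = 0" using \<open>x \<in> V\<close> s
        by (simp add: herm_scaleR_left V_def herm_commute[of s x])
      finally show ?thesis .
    qed
    then show ?thesis by (simp add: V_def)
  qed
  ultimately obtain x \<mu> where x: "x \<in> V" "norm x = 1" "A *v x = (\<mu>::real) *\<^sub>R x"
    using hermitian_eigenvector_in_invariant_subspace[OF A _ _ z] by blast
  have xx: "herm x x = 1" using x(2) by (simp add: herm_self)
  have "x \<notin> S" using x(1) xx by (auto simp: V_def)
  moreover have "herm x s = 0" "herm s x = 0" if "s \<in> S" for s
    using x(1) that herm_commute[of s x] by (auto simp: V_def)
  then have "orthonormal_set (insert x S)"
    using S(3) xx \<open>x \<notin> S\<close> by (auto simp: orthonormal_set_def)
  ultimately show ?case
    using S x(3) by (intro exI[of _ "insert x S"]) auto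
qed

definition unitary_matrix :: "complex^'d^'d::finite \<Rightarrow> bool" where
  "unitary_matrix U \<longleftrightarrow> U ** conj_transpose U = mat 1 \<and> conj_transpose U ** U = mat 1"

lemma mult_diag_matrix: "(B ** diag_matrix \<mu>) $ i $ j = B $ i $ j * complex_of_real (\<mu> j)"
proof -
  have "(B ** diag_matrix \<mu>) $ i $ j = (\<Sum>k\<in>UNIV. if k = j then B $ i $ k * complex_of_real (\<mu> k) else 0)"
    unfolding matrix_matrix_mult_def diag_matrix_def
    by (simp only: vec_lambda_beta) (rule sum.cong, auto)
  then show ?thesis by simp
qed

lemma diag_matrix_mult: "(diag_matrix \<mu> ** B) $ i $ j = complex_of_real (\<mu> i) * B $ i $ j"
proof -
  have "(diag_matrix \<mu> ** B) $ i $ j = (\<Sum>k\<in>UNIV. if k = i then complex_of_real (\<mu> i) * B $ k $ j else 0)"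
    unfolding matrix_matrix_mult_def diag_matrix_def
    by (simp only: vec_lambda_beta) (rule sum.cong, auto)
  then show ?thesis by simp
qed

lemma positive_definite_diagonalisation:
  fixes A :: "complex^'d^'d::finite"
  assumes "positive_definite A"
  shows "\<exists>U \<mu>. unitary_matrix U \<and> (\<forall>i. 0 < \<mu> i) \<and> A = U ** diag_matrix \<mu> ** conj_transpose U"
proof -
  have A: "conj_transpose A = A" and pos: "\<And>e. e \<noteq> 0 \<Longrightarrow> 0 < Re (herm (A *v e) e)"
    using assms by (auto simp: positive_definite_def herm_def)
  obtain S where S: "finite S" "card S = CARD('d)" "orthonormal_set S"
    "\<And>s. s \<in> S \<Longrightarrow> \<exists>\<mu>::real. A *v s = \<mu> *\<^sub>R s"
    using hermitian_orthonormal_eigenvectors[OF A le_refl] by auto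
  obtain u :: "'d \<Rightarrow> complex^'d" where u: "bij_betw u UNIV S"
    using finite_same_card_bij[of "UNIV :: 'd set" S] S by auto
  then have uS: "u i \<in> S" for i by (auto simp: bij_betw_def)
  have ortho: "herm (u i) (u j) = (if i = j then 1 else 0)" for i j
    using S(3) uS u by (auto simp: orthonormal_set_def bij_betw_def inj_on_def)
  obtain \<mu> where \<mu>: "\<And>i. A *v u i = \<mu> i *\<^sub>R u i" using S(4)[OF uS] by metis
  have \<mu>pos: "0 < \<mu> i" for i
  proof -
    have "u i \<noteq> 0" using ortho[of i i] by auto
    from pos[OF this] show ?thesis by (simp add: \<mu> herm_scaleR_left ortho)
  qed
  define U where "U = (\<chi> i j. u j $ i)"
  have UU: "conj_transpose U ** U = mat 1"
    using ortho unfolding U_def conj_transpose_def matrix_matrix_mult_def mat_def herm_def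
    by (auto simp: vec_eq_iff mult.commute[of "cnj _"])
  then have UU': "U ** conj_transpose U = mat 1" by (simp add: matrix_left_right_inverse)
  have "A ** U = U ** diag_matrix \<mu>"
  proof -
    have "(A ** U) $ i $ j = (U ** diag_matrix \<mu>) $ i $ j" for i j
    proof -
      have "(A ** U) $ i $ j = (A *v u j) $ i"
        by (simp add: matrix_matrix_mult_def matrix_vector_mult_def U_def)
      also have "\<dots> = (U ** diag_matrix \<mu>) $ i $ j"
        unfolding \<mu> mult_diag_matrix by (simp add: U_def scaleR_conv_of_real[where 'a=complex] mult.commute)
      finally show ?thesis .
    qed
    then show ?thesis by (simp add: vec_eq_iff)
  qed
  then have "A = U ** diag_matrix \<mu> ** conj_transpose U"
    by (metis UU' matrix_mul_assoc matrix_mul_rid)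
  then show ?thesis using UU UU' \<mu>pos unfolding unitary_matrix_def by blast
qed

text \<open>A function of a matrix is independent of the diagonalisation through which it is computed. This
  justifies the definite description in the definition of \<open>matrix_powr\<close>.\<close>

lemma diagonalised_power_unique:
  fixes U V :: "complex^'d^'d::finite"
  assumes U: "unitary_matrix U" and V: "unitary_matrix V"
    and eq: "U ** diag_matrix \<mu> ** conj_transpose U = V ** diag_matrix \<nu> ** conj_transpose V"
  shows "U ** diag_matrix (\<lambda>i. h (\<mu> i)) ** conj_transpose U
    = V ** diag_matrix (\<lambda>i. h (\<nu> i)) ** conj_transpose V"
proof -
  define X where "X = conj_transpose V ** U"
  have VX: "V ** X = U" and XU: "X ** conj_transpose U = conj_transpose V"
    using U V unfolding X_def unitary_matrix_def
    by (metis matrix_mul_assoc matrix_mul_lid, metis matrix_mul_assoc matrix_mul_rid)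
  have "X ** diag_matrix \<mu> = conj_transpose V ** (U ** diag_matrix \<mu> ** conj_transpose U) ** U"
    using U unfolding X_def unitary_matrix_def by (metis matrix_mul_assoc matrix_mul_rid)
  also have "\<dots> = diag_matrix \<nu> ** X"
    using V unfolding eq X_def unitary_matrix_def by (metis matrix_mul_assoc matrix_mul_lid)
  finally have "X $ i $ j * complex_of_real (\<mu> j) = complex_of_real (\<nu> i) * X $ i $ j" for i j
    by (metis mult_diag_matrix diag_matrix_mult)
  \<comment> \<open>\<open>X\<close> intertwines the two diagonal matrices, hence only couples equal eigenvalues.\<close>
  then have "X $ i $ j = 0 \<or> \<mu> j = \<nu> i" for i j
    by (metis mult.commute mult_cancel_left of_real_eq_iff)
  then have "X ** diag_matrix (\<lambda>i. h (\<mu> i)) = diag_matrix (\<lambda>i. h (\<nu> i)) ** X"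
    by (simp add: vec_eq_iff mult_diag_matrix diag_matrix_mult) (metis mult.commute mult_zero_left)
  then have "V ** (X ** diag_matrix (\<lambda>i. h (\<mu> i))) ** conj_transpose U
      = V ** (diag_matrix (\<lambda>i. h (\<nu> i)) ** X) ** conj_transpose U" by simp
  then show ?thesis using VX XU by (metis matrix_mul_assoc)
qed

lemma matrix_powr_diagonalised:
  fixes U :: "complex^'d^'d::finite"
  assumes U: "unitary_matrix U" and \<mu>: "\<And>i. 0 < \<mu> i"
    and A: "A = U ** diag_matrix \<mu> ** conj_transpose U"
  shows "matrix_powr A s = U ** diag_matrix (\<lambda>i. \<mu> i powr s) ** conj_transpose U"
  unfolding matrix_powr_def
proof (rule the_equality)
  show "\<exists>V \<nu>. V ** conj_transpose V = mat 1 \<and> conj_transpose V ** V = mat 1 \<and> (\<forall>i. 0 < \<nu> i) \<and>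
      A = V ** diag_matrix \<nu> ** conj_transpose V \<and>
      U ** diag_matrix (\<lambda>i. \<mu> i powr s) ** conj_transpose U
        = V ** diag_matrix (\<lambda>i. \<nu> i powr s) ** conj_transpose V"
    using assms unfolding unitary_matrix_def by blast
next
  fix B
  assume "\<exists>V \<nu>. V ** conj_transpose V = mat 1 \<and> conj_transpose V ** V = mat 1 \<and> (\<forall>i. 0 < \<nu> i) \<and>
      A = V ** diag_matrix \<nu> ** conj_transpose V \<and>
      B = V ** diag_matrix (\<lambda>i. \<nu> i powr s) ** conj_transpose V"
  then obtain V \<nu> where "unitary_matrix V" "A = V ** diag_matrix \<nu> ** conj_transpose V"
    "B = V ** diag_matrix (\<lambda>i. \<nu> i powr s) ** conj_transpose V"
    unfolding unitary_matrix_def by blast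
  then show "B = U ** diag_matrix (\<lambda>i. \<mu> i powr s) ** conj_transpose U"
    using diagonalised_power_unique[OF U, of V \<mu> \<nu> "\<lambda>x. x powr s"] A by simp
qed

lemma conjugated_diag_mult:
  assumes "unitary_matrix U"
  shows "(U ** diag_matrix \<mu> ** conj_transpose U) ** (U ** diag_matrix \<nu> ** conj_transpose U)
    = U ** diag_matrix (\<lambda>i. \<mu> i * \<nu> i) ** conj_transpose U"
proof -
  have "diag_matrix \<mu> ** diag_matrix \<nu> = diag_matrix (\<lambda>i. \<mu> i * \<nu> i)"
    by (simp add: vec_eq_iff diag_matrix_mult) (simp add: diag_matrix_def)
  then have "U ** diag_matrix (\<lambda>i. \<mu> i * \<nu> i) ** conj_transpose U
      = U ** diag_matrix \<mu> ** mat 1 ** diag_matrix \<nu> ** conj_transpose U"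
    by (simp add: matrix_mul_assoc[symmetric])
  also have "mat 1 = conj_transpose U ** U"
    using assms by (simp add: unitary_matrix_def)
  finally show ?thesis by (simp add: matrix_mul_assoc)
qed

lemma matrix_powr_minus_mult:
  assumes "positive_definite A"
  shows "matrix_powr A (- s) ** matrix_powr A s = mat 1"
proof -
  obtain U \<mu> where U: "unitary_matrix U" and \<mu>: "\<And>i. 0 < \<mu> i"
    and A: "A = U ** diag_matrix \<mu> ** conj_transpose U"
    using positive_definite_diagonalisation[OF assms] by blast
  have one: "diag_matrix (\<lambda>i. \<mu> i powr (- s) * \<mu> i powr s) = mat 1"
    using \<mu> by (auto simp: diag_matrix_def mat_def vec_eq_iff powr_add[symmetric] less_le)
  show ?thesis
    unfolding matrix_powr_diagonalised[OF U \<mu> A] conjugated_diag_mult[OF U] one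
    using U by (simp add: unitary_matrix_def)
qed

lemma conjugated_diag_entry:
  "(U ** diag_matrix \<mu> ** conj_transpose U) $ i $ j
    = (\<Sum>k\<in>UNIV. U $ i $ k * cnj (U $ j $ k) * complex_of_real (\<mu> k))"
proof -
  have "(U ** diag_matrix \<mu> ** conj_transpose U) $ i $ j
      = (\<Sum>k\<in>UNIV. (U ** diag_matrix \<mu>) $ i $ k * conj_transpose U $ k $ j)"
    by (simp add: matrix_matrix_mult_def)
  then show ?thesis by (simp add: mult_diag_matrix conj_transpose_def algebra_simps)
qed

fun matrix_power :: "complex^'d^'d::finite \<Rightarrow> nat \<Rightarrow> complex^'d^'d" where
  "matrix_power X 0 = mat 1"
| "matrix_power X (Suc n) = X ** matrix_power X n"

lemma matrix_power_conjugated_diag: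
  fixes U :: "complex^'d^'d::finite"
  assumes "unitary_matrix U"
  shows "matrix_power (U ** diag_matrix z ** conj_transpose U) n
    = U ** diag_matrix (\<lambda>i. z i ^ n) ** conj_transpose U"
proof (induction n)
  case 0
  have "diag_matrix (\<lambda>i. 1) = (mat 1 :: complex^'d^'d)" by (auto simp: diag_matrix_def mat_def vec_eq_iff)
  then show ?case using assms by (simp add: unitary_matrix_def)
next
  case (Suc n)
  then show ?case by (simp add: conjugated_diag_mult[OF assms])
qed

text \<open>After division by a number above its trace a positive definite matrix differs from the identity
  by a matrix with eigenvalues in \<open>(-1, 0)\<close>, so its powers are given by the binomial series. The
  partial sums are polynomials in the entries, which is what makes the power measurable.\<close>

lemma matrix_powr_binomial_series:
  fixes A :: "complex^'d^'d::finite"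
  assumes "positive_definite A"
  defines "c \<equiv> 1 + Re (trace A)"
  shows "(\<lambda>N. of_real (c powr s) *
      (\<Sum>n<N. of_real (s gchoose n) * matrix_power ((\<chi> i j. of_real (1 / c) * A $ i $ j) - mat 1) n $ i $ j))
    \<longlonglongrightarrow> matrix_powr A s $ i $ j"
proof -
  obtain U \<mu> where U: "unitary_matrix U" and \<mu>: "\<And>i. 0 < \<mu> i"
    and A: "A = U ** diag_matrix \<mu> ** conj_transpose U"
    using positive_definite_diagonalisation[OF assms(1)] by blast
  have "trace A = trace (conj_transpose U ** (U ** diag_matrix \<mu>))"
    unfolding A by (rule trace_mul_sym)
  also have "\<dots> = trace (diag_matrix \<mu>)"
    using U by (simp add: matrix_mul_assoc unitary_matrix_def)
  also have "\<dots> = of_real (\<Sum>k\<in>UNIV. \<mu> k)"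
    by (simp add: trace_def diag_matrix_def)
  finally have c: "c = 1 + (\<Sum>k\<in>UNIV. \<mu> k)" by (simp add: c_def)
  have \<mu>c: "\<mu> k < c" for k
    using member_le_sum[of k UNIV \<mu>] \<mu> by (simp add: c less_imp_le add.commute add_strict_increasing)
  have c0: "c > 0" using \<mu> \<mu>c less_trans by blast
  define z where "z = (\<lambda>k. \<mu> k / c - 1)"
  have z: "\<bar>z k\<bar> < 1" for k
    using \<mu>[of k] \<mu>c[of k] c0 by (simp add: z_def abs_if)
  have one: "mat 1 = U ** diag_matrix (\<lambda>k. 1) ** conj_transpose U"
    using matrix_power_conjugated_diag[OF U, of z 0] by simp
  have X: "(\<chi> i j. of_real (1 / c) * A $ i $ j) - mat 1 = U ** diag_matrix z ** conj_transpose U"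
    unfolding vec_eq_iff
    by (simp add: one A conjugated_diag_entry z_def sum_distrib_left sum_subtractf[symmetric] algebra_simps
        del: matrix_mul_rid)
  have "(\<lambda>N. of_real (c powr s) * (\<Sum>k\<in>UNIV. U $ i $ k * cnj (U $ j $ k) *
        of_real (\<Sum>n<N. (s gchoose n) * z k ^ n)))
      \<longlonglongrightarrow> of_real (c powr s) * (\<Sum>k\<in>UNIV. U $ i $ k * cnj (U $ j $ k) * of_real ((1 + z k) powr s))"
    using gen_binomial_real[OF z, where a = s]
    by (intro tendsto_intros) (simp add: sums_def)
  also have "(\<lambda>N. of_real (c powr s) * (\<Sum>k\<in>UNIV. U $ i $ k * cnj (U $ j $ k) *
        of_real (\<Sum>n<N. (s gchoose n) * z k ^ n))) = (\<lambda>N. of_real (c powr s) *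
      (\<Sum>n<N. of_real (s gchoose n) * matrix_power ((\<chi> i j. of_real (1 / c) * A $ i $ j) - mat 1) n $ i $ j))"
    unfolding X matrix_power_conjugated_diag[OF U] conjugated_diag_entry of_real_sum sum_distrib_left
    by (subst sum.swap) (simp add: algebra_simps)
  also have "of_real (c powr s) * (\<Sum>k\<in>UNIV. U $ i $ k * cnj (U $ j $ k) * of_real ((1 + z k) powr s))
      = matrix_powr A s $ i $ j"
  proof -
    have "c powr s * (1 + z k) powr s = \<mu> k powr s" for k
      using c0 \<mu>[of k] by (simp add: z_def powr_mult[symmetric])
    then have "of_real (c powr s) * complex_of_real ((1 + z k) powr s) = of_real (\<mu> k powr s)" for k
      by (metis of_real_mult)
    then show ?thesis
      unfolding matrix_powr_diagonalised[OF U \<mu> A] conjugated_diag_entry sum_distrib_left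
      by (intro sum.cong) (simp_all add: mult.left_commute)
  qed
  finally show ?thesis .
qed

text \<open>Each entry of the power is almost everywhere the limit of the measurable partial sums of the
  binomial series, and completeness of the Lebesgue measure does the rest.\<close>

lemma measurable_matrix_powr_norm:
  fixes W :: "'a::euclidean_space \<Rightarrow> complex^'d^'d::finite"
  assumes W: "W \<in> borel_measurable lebesgue" and pd: "AE x in lebesgue. positive_definite (W x)"
  shows "(\<lambda>x. norm (matrix_powr (W x) s *v e)) \<in> borel_measurable lebesgue"
proof -
  have [measurable]: "(\<lambda>x. W x $ i $ j) \<in> borel_measurable lebesgue" for i j
    by (rule measurable_compose[OF W]) (intro borel_measurable_continuous_onI continuous_intros)
  define c where "c = (\<lambda>x. 1 + Re (trace (W x)))"
  have [measurable]: "c \<in> borel_measurable lebesgue"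
    unfolding c_def trace_def by measurable
  define X where "X = (\<lambda>x. (\<chi> i j. of_real (1 / c x) * W x $ i $ j) - mat 1 :: complex^'d^'d)"
  have X: "(\<lambda>x. X x $ i $ j) \<in> borel_measurable lebesgue" for i j
    unfolding X_def by simp
  have P [measurable]: "(\<lambda>x. matrix_power (X x) n $ i $ j) \<in> borel_measurable lebesgue" for n i j
  proof (induction n arbitrary: i j)
    case (Suc n)
    then show ?case using X by (simp add: matrix_matrix_mult_def)
  qed simp
  have entry: "(\<lambda>x. matrix_powr (W x) s $ i $ j) \<in> borel_measurable lebesgue" for i j
  proof -
    define L where "L = (\<lambda>x. lim (\<lambda>N. of_real (c x powr s) *
      (\<Sum>n<N. of_real (s gchoose n) * matrix_power (X x) n $ i $ j)))"
    have "L \<in> borel_measurable lebesgue"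
      unfolding L_def by measurable
    moreover have "AE x in lebesgue. L x = matrix_powr (W x) s $ i $ j"
      using pd
    proof eventually_elim
      case (elim x)
      show ?case unfolding L_def X_def c_def
        by (rule limI[OF matrix_powr_binomial_series[OF elim]])
    qed
    ultimately show ?thesis by (rule borel_measurable_AE)
  qed
  show ?thesis
    unfolding norm_vec_def L2_set_def matrix_vector_mult_def using entry by simp
qed

lemma locally_integrable_imp_measurable:
  fixes f :: "'a::euclidean_space \<Rightarrow> 'b::euclidean_space"
  assumes "locally_integrable f"
  shows "f \<in> borel_measurable lebesgue"
proof (rule borel_measurable_LIMSEQ_metric)
  show "(\<lambda>x. indicator (cball 0 (real n)) x *\<^sub>R f x) \<in> borel_measurable lebesgue" for n
    using assms compact_cball unfolding locally_integrable_def set_integrable_def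
    by (blast intro: borel_measurable_integrable)
  show "(\<lambda>n. indicator (cball 0 (real n)) x *\<^sub>R f x) \<longlonglongrightarrow> f x" for x
  proof (rule tendsto_eventually)
    obtain n0 :: nat where "norm x \<le> real n0" using real_arch_simple by blast
    then show "\<forall>\<^sub>F n in sequentially. indicator (cball 0 (real n)) x *\<^sub>R f x = f x"
      unfolding eventually_sequentially by (intro exI[of _ n0]) (auto simp: indicator_def)
  qed
qed


section \<open>Powers with values in the extended half line\<close>

lemma ennreal_powr_ennreal [simp]: "0 \<le> a \<Longrightarrow> ennreal_powr (ennreal a) s = ennreal (a powr s)"
  by (simp add: ennreal_powr_def)

lemma ennreal_powr_infinity [simp]: "ennreal_powr \<infinity> s = \<infinity>" "ennreal_powr top s = top"
  by (simp_all add: ennreal_powr_def)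

lemma ennreal_powr_zero [simp]: "ennreal_powr 0 s = 0"
  using ennreal_powr_ennreal[of 0 s] by (simp del: ennreal_powr_ennreal)

lemma ennreal_powr_mono:
  assumes "0 \<le> s" "x \<le> y"
  shows "ennreal_powr x s \<le> ennreal_powr y s"
proof (cases y)
  case (real b)
  then obtain a where "0 \<le> a" "a \<le> b" "x = ennreal a"
    using assms(2) by (cases x) (auto simp: top_unique)
  then show ?thesis using assms(1) real by (simp add: ennreal_leI powr_mono2)
qed simp

lemma ennreal_powr_mult: "ennreal_powr (x * y) s = ennreal_powr x s * ennreal_powr y s"
  if "0 < s" for x y :: ennreal
proof (cases x; cases y)
  fix a b assume "0 \<le> a" "0 \<le> b" "x = ennreal a" "y = ennreal b"
  then show ?thesis by (simp add: ennreal_mult[symmetric] powr_mult)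
next
  fix a assume a: "0 \<le> a" "x = ennreal a" "y = top"
  then show ?thesis
    by (cases "a = 0") (simp_all add: ennreal_mult_top ennreal_powr_def)
next
  fix a assume a: "0 \<le> a" "y = ennreal a" "x = top"
  then show ?thesis
    by (cases "a = 0") (simp_all add: ennreal_top_mult ennreal_powr_def)
qed simp

lemma ennreal_powr_powr: "ennreal_powr (ennreal_powr x s) t = ennreal_powr x (s * t)"
  by (cases x) (simp_all add: powr_powr)

lemma ennreal_powr_one [simp]: "ennreal_powr x 1 = x"
  by (cases x) simp_all

lemma measurable_ennreal_powr [measurable]:
  assumes [measurable]: "f \<in> borel_measurable M"
  shows "(\<lambda>x. ennreal_powr (f x) s) \<in> borel_measurable M"
proof -
  have "{x \<in> space M. f x = \<infinity>} = f -` {\<infinity>} \<inter> space M" by auto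
  then have "{x \<in> space M. f x = \<infinity>} \<in> sets M" by simp
  then show ?thesis
    unfolding ennreal_powr_def by (intro measurable_If) measurable
qed

lemma ennreal_powr_SUP:
  fixes X :: "nat \<Rightarrow> ennreal"
  assumes s: "0 < s"
  shows "ennreal_powr (SUP n. X n) s = (SUP n. ennreal_powr (X n) s)"
proof (rule antisym)
  show "(SUP n. ennreal_powr (X n) s) \<le> ennreal_powr (SUP n. X n) s"
    using s by (intro SUP_least ennreal_powr_mono SUP_upper) auto
  define Y where "Y = (SUP n. ennreal_powr (X n) s)"
  have "X n \<le> ennreal_powr Y (1 / s)" for n
  proof -
    have "X n = ennreal_powr (ennreal_powr (X n) s) (1 / s)"
      using s by (simp add: ennreal_powr_powr)
    also have "\<dots> \<le> ennreal_powr Y (1 / s)"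
      unfolding Y_def using s by (intro ennreal_powr_mono SUP_upper) auto
    finally show ?thesis .
  qed
  then have "(SUP n. X n) \<le> ennreal_powr Y (1 / s)" by (rule SUP_least)
  then have "ennreal_powr (SUP n. X n) s \<le> ennreal_powr (ennreal_powr Y (1 / s)) s"
    using s by (intro ennreal_powr_mono) auto
  then show "ennreal_powr (SUP n. X n) s \<le> (SUP n. ennreal_powr (X n) s)"
    using s by (simp add: ennreal_powr_powr Y_def)
qed

text \<open>Young's inequality with a free parameter, in a form that lets the second term be absorbed.\<close>

lemma young_ennreal:
  fixes x y :: ennreal
  assumes q: "1 < q" and K: "0 < K"
  shows "x * ennreal_powr y (q - 1)
    \<le> ennreal (K powr (q - 1)) * ennreal_powr x q + ennreal (1 / K) * ennreal_powr y q"
proof (cases x; cases y)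
  fix a b assume ab: "0 \<le> a" "0 \<le> b" "x = ennreal a" "y = ennreal b"
  have "a * b powr (q - 1) \<le> K powr (q - 1) * a powr q + (1 / K) * b powr q"
  proof (cases "b \<le> K * a")
    case True
    then have "b powr (q - 1) \<le> (K * a) powr (q - 1)"
      using q ab by (intro powr_mono2) auto
    then have "a * b powr (q - 1) \<le> a * (K powr (q - 1) * a powr (q - 1))"
      using ab K by (intro mult_left_mono) (auto simp: powr_mult)
    also have "\<dots> = K powr (q - 1) * a powr q"
      using ab by (cases "a = 0") (simp_all add: powr_mult_base[of a "q - 1"])
    also have "\<dots> \<le> K powr (q - 1) * a powr q + (1 / K) * b powr q"
      using K by simp
    finally show ?thesis .
  next
    case False
    then have "a \<le> b / K" using K by (simp add: field_simps)
    then have "a * b powr (q - 1) \<le> (b / K) * b powr (q - 1)"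
      by (intro mult_right_mono) auto
    also have "\<dots> = (1 / K) * b powr q"
      using ab by (simp add: powr_mult_base[of b "q - 1"])
    also have "\<dots> \<le> K powr (q - 1) * a powr q + (1 / K) * b powr q"
      by simp
    finally show ?thesis .
  qed
  then show ?thesis
    using ab K by (simp add: ennreal_mult[symmetric] ennreal_plus[symmetric] ennreal_leI
        del: ennreal_plus)
next
  assume "y = top"
  then show ?thesis using K by (simp add: ennreal_mult_top)
next
  assume "x = top"
  then show ?thesis using K by (simp add: ennreal_mult_top)
qed (use K in \<open>simp add: ennreal_mult_top\<close>)

lemma ennreal_absorb_half:
  fixes X Y :: ennreal
  assumes "X \<le> Y + ennreal (1 / 2) * X" "X < \<infinity>"
  shows "X \<le> 2 * Y"
proof (cases Y)
  case (real b)
  obtain a where a: "0 \<le> a" "X = ennreal a" using assms(2) by (cases X) auto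
  have "ennreal (b + 1 / 2 * a) = ennreal b + ennreal (1 / 2) * ennreal a"
    using a real by (subst ennreal_plus) (auto simp: ennreal_mult[symmetric] simp del: ennreal_half)
  then have "ennreal a \<le> ennreal (b + 1 / 2 * a)"
    using assms(1) a real by simp
  then have "a \<le> b + 1 / 2 * a" using a real by (subst (asm) ennreal_le_iff) auto
  then have "a \<le> 2 * b" by simp
  then have "ennreal a \<le> ennreal (2 * b)" by (rule ennreal_leI)
  then show ?thesis using a real by (simp add: ennreal_mult)
qed (simp add: ennreal_mult_top)


section \<open>Maximal functions of finite families of sets\<close>

definition mean :: "'a measure \<Rightarrow> 'a set \<Rightarrow> ('a \<Rightarrow> ennreal) \<Rightarrow> ennreal" where
  "mean M Q g = (\<integral>\<^sup>+x\<in>Q. g x \<partial>M) / emeasure M Q"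

text \<open>Writing the restriction to sets containing the point as an indicator makes the supremum range over
  a family that does not depend on the point, which gives measurability; points outside all sets get the value \<open>0\<close>.\<close>

definition maximal_function :: "'a measure \<Rightarrow> 'a set set \<Rightarrow> ('a \<Rightarrow> ennreal) \<Rightarrow> 'a \<Rightarrow> ennreal" where
  "maximal_function M \<F> g x = (SUP Q\<in>\<F>. mean M Q g * indicator Q x)"

definition averaging_family :: "'a measure \<Rightarrow> 'a set set \<Rightarrow> bool" where
  "averaging_family M \<F> \<longleftrightarrow>
     finite \<F> \<and> (\<forall>Q\<in>\<F>. Q \<in> sets M \<and> 0 < emeasure M Q \<and> emeasure M Q < \<infinity>)"

definition nested :: "'a set set \<Rightarrow> bool" where
  "nested \<F> \<longleftrightarrow> (\<forall>Q\<in>\<F>. \<forall>Q'\<in>\<F>. Q \<subseteq> Q' \<or> Q' \<subseteq> Q \<or> Q \<inter> Q' = {})"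

lemma mean_times_measure:
  assumes "0 < emeasure M Q" "emeasure M Q < \<infinity>"
  shows "mean M Q g * emeasure M Q = (\<integral>\<^sup>+x\<in>Q. g x \<partial>M)"
  unfolding mean_def using assms by (simp add: ennreal_divide_times less_top[symmetric])

lemma mean_le_maximal_function: "Q \<in> \<F> \<Longrightarrow> x \<in> Q \<Longrightarrow> mean M Q g \<le> maximal_function M \<F> g x"
  unfolding maximal_function_def by (rule SUP_upper2[of Q]) auto

lemma mean_mono:
  assumes "\<And>x. x \<in> Q \<Longrightarrow> g x \<le> h x"
  shows "mean M Q g \<le> mean M Q h"
  unfolding mean_def using assms
  by (intro divide_right_mono_ennreal nn_integral_mono) (auto simp: indicator_def)

lemma mean_const:
  assumes "Q \<in> sets M" "0 < emeasure M Q" "emeasure M Q < \<infinity>"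
  shows "mean M Q (\<lambda>_. c) = c"
  unfolding mean_def using assms
  by (simp add: nn_integral_cmult_indicator ennreal_times_divide[symmetric] ennreal_divide_self less_top[symmetric])

lemma measurable_maximal_function [measurable]:
  assumes "averaging_family M \<F>"
  shows "maximal_function M \<F> g \<in> borel_measurable M"
  unfolding maximal_function_def[abs_def]
  using assms by (intro borel_measurable_SUP) (auto simp: averaging_family_def countable_finite)

lemma maximal_function_le_bound:
  assumes "averaging_family M \<F>" "\<And>x. g x \<le> B"
  shows "maximal_function M \<F> g x \<le> B * indicator (\<Union>\<F>) x"
  unfolding maximal_function_def
proof (rule SUP_least)
  fix Q assume Q: "Q \<in> \<F>"
  have "mean M Q g \<le> mean M Q (\<lambda>_. B)" by (rule mean_mono) (rule assms(2))
  also have "\<dots> = B" using assms(1) Q by (intro mean_const) (auto simp: averaging_family_def)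
  finally show "mean M Q g * indicator Q x \<le> B * indicator (\<Union>\<F>) x"
    using Q by (auto simp: indicator_def)
qed

text \<open>The level set is the union of the members whose mean exceeds \<open>c\<close>. The inclusion-maximal ones among
  them are pairwise disjoint by nestedness and have the same union, so their inequalities add up.\<close>

lemma maximal_function_weak_type:
  assumes \<F>: "averaging_family M \<F>" "nested \<F>" and g [measurable]: "g \<in> borel_measurable M"
  shows "c * emeasure M {x \<in> space M. c < maximal_function M \<F> g x}
    \<le> (\<integral>\<^sup>+x\<in>{x \<in> space M. c < maximal_function M \<F> g x}. g x \<partial>M)"
proof -
  define \<S> where "\<S> = {Q\<in>\<F>. c < mean M Q g}"
  define \<M> where "\<M> = {Q\<in>\<S>. \<forall>Q'\<in>\<S>. Q \<subseteq> Q' \<longrightarrow> Q = Q'}"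
  have fin: "finite \<S>" "finite \<M>" and sets: "\<And>Q. Q \<in> \<M> \<Longrightarrow> Q \<in> sets M"
    using \<F>(1) by (auto simp: \<S>_def \<M>_def averaging_family_def)
  have "{x \<in> space M. c < maximal_function M \<F> g x} = \<Union>\<S>"
  proof (intro set_eqI iffI)
    fix x assume "x \<in> {x \<in> space M. c < maximal_function M \<F> g x}"
    then obtain Q where "Q \<in> \<F>" "c < mean M Q g * indicator Q x"
      by (auto simp: maximal_function_def less_SUP_iff)
    then show "x \<in> \<Union>\<S>" by (cases "x \<in> Q") (auto simp: \<S>_def)
  next
    fix x assume "x \<in> \<Union>\<S>"
    then obtain Q where Q: "Q \<in> \<F>" "c < mean M Q g" "x \<in> Q" by (auto simp: \<S>_def)
    then have "c < maximal_function M \<F> g x"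
      using mean_le_maximal_function[of Q \<F> x M g] by auto
    moreover have "x \<in> space M"
      using Q \<F>(1) sets.sets_into_space by (fastforce simp: averaging_family_def)
    ultimately show "x \<in> {x \<in> space M. c < maximal_function M \<F> g x}" by simp
  qed
  also have "\<Union>\<S> = \<Union>\<M>"
  proof
    show "\<Union>\<S> \<subseteq> \<Union>\<M>"
    proof
      fix x assume "x \<in> \<Union>\<S>"
      then obtain Q where "Q \<in> \<S>" "x \<in> Q" by auto
      moreover obtain Q' where "Q' \<in> \<S>" "Q \<subseteq> Q'" "\<forall>P\<in>\<S>. Q' \<subseteq> P \<longrightarrow> Q' = P"
        using finite_has_maximal2[OF fin(1) \<open>Q \<in> \<S>\<close>] by auto
      ultimately show "x \<in> \<Union>\<M>" by (auto simp: \<M>_def)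
    qed
  qed (auto simp: \<M>_def)
  finally have level: "{x \<in> space M. c < maximal_function M \<F> g x} = \<Union>\<M>" .
  have disj: "disjoint_family_on id \<M>"
    unfolding disjoint_family_on_def
  proof (intro ballI impI)
    fix Q Q' assume Q: "Q \<in> \<M>" "Q' \<in> \<M>" "Q \<noteq> Q'"
    then have "\<not> Q \<subseteq> Q'" "\<not> Q' \<subseteq> Q" and "Q \<in> \<F>" "Q' \<in> \<F>"
      unfolding \<M>_def \<S>_def by blast+
    then show "id Q \<inter> id Q' = {}"
      using \<F>(2) unfolding nested_def id_def by blast
  qed
  have "c * emeasure M (\<Union>\<M>) = (\<Sum>Q\<in>\<M>. c * emeasure M Q)"
    using sum_emeasure[of id \<M> M] disj fin(2) sets by (simp add: subset_eq sum_distrib_left[symmetric])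
  also have "\<dots> \<le> (\<Sum>Q\<in>\<M>. \<integral>\<^sup>+x\<in>Q. g x \<partial>M)"
  proof (rule sum_mono)
    fix Q assume Q: "Q \<in> \<M>"
    then have "Q \<in> \<F>" "c \<le> mean M Q g"
      unfolding \<M>_def \<S>_def by (blast, simp add: less_imp_le)
    then have "c * emeasure M Q \<le> mean M Q g * emeasure M Q"
      by (intro mult_right_mono) auto
    also have "\<dots> = (\<integral>\<^sup>+x\<in>Q. g x \<partial>M)"
      using \<open>Q \<in> \<F>\<close> \<F>(1) by (intro mean_times_measure) (auto simp: averaging_family_def)
    finally show "c * emeasure M Q \<le> (\<integral>\<^sup>+x\<in>Q. g x \<partial>M)" .
  qed
  also have "\<dots> = (\<integral>\<^sup>+x. (\<Sum>Q\<in>\<M>. g x * indicator Q x) \<partial>M)"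
    using sets by (subst nn_integral_sum) auto
  also have "\<dots> = (\<integral>\<^sup>+x\<in>\<Union>\<M>. g x \<partial>M)"
  proof -
    have "(\<Sum>Q\<in>\<M>. indicator Q x) = (indicator (\<Union>\<M>) x :: ennreal)" for x
      by (simp add: indicator_UN_disjoint[of \<M> id, OF fin(2) disj, simplified])
    then show ?thesis by (simp add: sum_distrib_left[symmetric])
  qed
  finally show ?thesis unfolding level .
qed

lemma nn_integral_powr_below:
  assumes s: "0 < s" and r: "0 \<le> r"
  shows "(\<integral>\<^sup>+l. ennreal (s * l powr (s - 1)) * indicator {0..<r} l \<partial>lborel) = ennreal (r powr s)"
proof -
  have "((\<lambda>l. l powr (s - 1)) has_integral (r powr s / s)) {0..r}"
    using has_integral_powr_from_0[of "s - 1" r] s r by simp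
  then have "((\<lambda>l. s * l powr (s - 1)) has_integral r powr s) {0..r}"
    using has_integral_mult_right[of _ "r powr s / s" "{0..r}" s] s by fastforce
  then have "((\<lambda>l. if l \<in> {0..r} then s * l powr (s - 1) else 0) has_integral r powr s) UNIV"
    by (simp only: has_integral_restrict_UNIV)
  also have "(\<lambda>l. if l \<in> {0..r} then s * l powr (s - 1) else 0)
      = (\<lambda>l. indicator {0..r} l *\<^sub>R (s * l powr (s - 1)))"
    by (auto simp: indicator_def)
  finally have "((\<lambda>l. indicator {0..r} l *\<^sub>R (s * l powr (s - 1))) has_integral r powr s) UNIV" .
  then have "(\<integral>\<^sup>+l. ennreal (indicator {0..r} l *\<^sub>R (s * l powr (s - 1))) \<partial>lborel) = ennreal (r powr s)"
    using s by (intro nn_integral_has_integral_lborel) auto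
  moreover have "(\<integral>\<^sup>+l. ennreal (indicator {0..r} l *\<^sub>R (s * l powr (s - 1))) \<partial>lborel)
      = (\<integral>\<^sup>+l. ennreal (s * l powr (s - 1)) * indicator {0..<r} l \<partial>lborel)"
    using AE_lborel_singleton[of r]
    by (intro nn_integral_cong_AE) (auto elim!: eventually_mono simp: indicator_def)
  ultimately show ?thesis by simp
qed


text \<open>The layer cake formula, applied once to \<open>m\<^sup>q\<close> and, after the weak type bound, backwards to \<open>m\<^bsup>q-1\<^esup>\<close>; the
  constant \<open>q / (q - 1)\<close> is the ratio of the densities \<open>q l\<^bsup>q-2\<^esup>\<close> and \<open>(q - 1) l\<^bsup>q-2\<^esup>\<close>.\<close>

lemma nn_integral_powr_le_of_weak_type:
  fixes m :: "'a \<Rightarrow> real"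
  assumes M: "sigma_finite_measure M" and q: "1 < q"
    and m [measurable]: "m \<in> borel_measurable M" and m0: "\<And>x. 0 \<le> m x"
    and g [measurable]: "g \<in> borel_measurable M"
    and weak: "\<And>l. 0 < l \<Longrightarrow> ennreal l * emeasure M {x \<in> space M. l < m x}
        \<le> (\<integral>\<^sup>+x\<in>{x \<in> space M. l < m x}. g x \<partial>M)"
  shows "(\<integral>\<^sup>+x. ennreal (m x powr q) \<partial>M)
    \<le> ennreal (q / (q - 1)) * (\<integral>\<^sup>+x. g x * ennreal (m x powr (q - 1)) \<partial>M)"
proof -
  interpret M: sigma_finite_measure M by (rule M)
  interpret P: pair_sigma_finite M lborel ..
  have [measurable]: "Measurable.pred (M \<Otimes>\<^sub>M lborel) (\<lambda>(x, l). l < m x)" by measurable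
  define \<phi> where "\<phi> = (\<lambda>s x l. ennreal (s * l powr (s - 1)) * indicator {0..<m x} l)"
  have \<phi>: "\<phi> s x l = ennreal (s * l powr (s - 1)) * indicator {0..} l * indicator {x. l < m x} x" for s x l
    by (auto simp: \<phi>_def indicator_def)
  have \<phi>_measurable [measurable]: "case_prod (\<phi> s) \<in> borel_measurable (M \<Otimes>\<^sub>M lborel)" for s
    unfolding \<phi> by measurable
  have layer: "(\<integral>\<^sup>+l. \<phi> s x l \<partial>lborel) = ennreal (m x powr s)" if "0 < s" for s x
    unfolding \<phi>_def using that m0 by (rule nn_integral_powr_below)
  have level: "(\<integral>\<^sup>+x. \<phi> q x l \<partial>M)
      \<le> (\<integral>\<^sup>+x. ennreal (q / (q - 1)) * (g x * \<phi> (q - 1) x l) \<partial>M)" for l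
  proof (cases "0 < l")
    case True
    have "(\<integral>\<^sup>+x. \<phi> q x l \<partial>M) = (\<integral>\<^sup>+x. ennreal (q * l powr (q - 1)) * indicator {x \<in> space M. l < m x} x \<partial>M)"
      using True by (intro nn_integral_cong) (auto simp: \<phi> indicator_def)
    also have "\<dots> = ennreal (q * l powr (q - 1)) * emeasure M {x \<in> space M. l < m x}"
      by (rule nn_integral_cmult_indicator) measurable
    also have "ennreal (q * l powr (q - 1)) = ennreal (q * l powr (q - 2)) * ennreal l"
      using True q powr_mult_base[of l "q - 2"] by (simp add: ennreal_mult[symmetric] algebra_simps)
    also have "\<dots> * emeasure M {x \<in> space M. l < m x}
        \<le> ennreal (q * l powr (q - 2)) * (\<integral>\<^sup>+x\<in>{x \<in> space M. l < m x}. g x \<partial>M)"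
      using weak[OF True] by (simp add: mult.assoc mult_left_mono)
    also have "\<dots> = (\<integral>\<^sup>+x. ennreal (q * l powr (q - 2)) * (g x * indicator {x \<in> space M. l < m x} x) \<partial>M)"
      by (rule nn_integral_cmult[symmetric]) measurable
    also have "\<dots> = (\<integral>\<^sup>+x. ennreal (q / (q - 1)) * (g x * \<phi> (q - 1) x l) \<partial>M)"
    proof (rule nn_integral_cong)
      fix x assume "x \<in> space M"
      have "ennreal (q * l powr (q - 2)) = ennreal (q / (q - 1)) * ennreal ((q - 1) * l powr (q - 1 - 1))"
        using q by (simp add: ennreal_mult[symmetric])
      then show "ennreal (q * l powr (q - 2)) * (g x * indicator {x \<in> space M. l < m x} x)
          = ennreal (q / (q - 1)) * (g x * \<phi> (q - 1) x l)"
        using True \<open>x \<in> space M\<close> by (auto simp: \<phi> indicator_def mult.assoc mult.commute[of "g x"])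
    qed
    finally show ?thesis .
  next
    case False
    then have "\<phi> q x l = 0" for x
      using q by (cases "l = 0") (auto simp: \<phi>_def indicator_def)
    then show ?thesis by simp
  qed
  have "(\<integral>\<^sup>+x. ennreal (m x powr q) \<partial>M) = (\<integral>\<^sup>+x. \<integral>\<^sup>+l. \<phi> q x l \<partial>lborel \<partial>M)"
    using q by (simp add: layer)
  also have "\<dots> = (\<integral>\<^sup>+l. \<integral>\<^sup>+x. \<phi> q x l \<partial>M \<partial>lborel)"
    by (rule P.Fubini'[symmetric]) measurable
  also have "\<dots> \<le> (\<integral>\<^sup>+l. \<integral>\<^sup>+x. ennreal (q / (q - 1)) * (g x * \<phi> (q - 1) x l) \<partial>M \<partial>lborel)"
    by (intro nn_integral_mono level)
  also have "\<dots> = (\<integral>\<^sup>+x. \<integral>\<^sup>+l. ennreal (q / (q - 1)) * (g x * \<phi> (q - 1) x l) \<partial>lborel \<partial>M)"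
    by (rule P.Fubini') measurable
  also have "\<dots> = (\<integral>\<^sup>+x. ennreal (q / (q - 1)) * (g x * ennreal (m x powr (q - 1))) \<partial>M)"
  proof (rule nn_integral_cong)
    fix x assume "x \<in> space M"
    then have [measurable]: "\<phi> (q - 1) x \<in> borel_measurable lborel"
      unfolding \<phi>_def by measurable
    show "(\<integral>\<^sup>+l. ennreal (q / (q - 1)) * (g x * \<phi> (q - 1) x l) \<partial>lborel)
        = ennreal (q / (q - 1)) * (g x * ennreal (m x powr (q - 1)))"
      using q by (simp add: nn_integral_cmult layer)
  qed
  also have "\<dots> = ennreal (q / (q - 1)) * (\<integral>\<^sup>+x. g x * ennreal (m x powr (q - 1)) \<partial>M)"
    by (rule nn_integral_cmult) measurable
  finally show ?thesis .
qed

definition maximal_const :: "real \<Rightarrow> real" where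
  "maximal_const q = (2 * q / (q - 1)) powr q"

text \<open>Doob's inequality. Young's inequality splits \<open>g m\<^bsup>q-1\<^esup>\<close>, and the part with \<open>m\<^sup>q\<close> can be absorbed since the
  maximal function of a bounded function over a finite family has finite norm.\<close>

lemma maximal_function_strong_type:
  assumes M: "sigma_finite_measure M" and \<F>: "averaging_family M \<F>" "nested \<F>" and q: "1 < q"
    and g [measurable]: "g \<in> borel_measurable M" and bound: "\<And>x. g x \<le> ennreal B"
  shows "(\<integral>\<^sup>+x. ennreal_powr (maximal_function M \<F> g x) q \<partial>M)
    \<le> ennreal (maximal_const q) * (\<integral>\<^sup>+x. ennreal_powr (g x) q \<partial>M)"
proof -
  define m where "m = (\<lambda>x. enn2real (maximal_function M \<F> g x))"
  have le_B: "maximal_function M \<F> g x \<le> ennreal B * indicator (\<Union>\<F>) x" for x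
    by (rule maximal_function_le_bound[OF \<F>(1) bound])
  also have "ennreal B * indicator (\<Union>\<F>) x < \<infinity>" for x by (simp add: indicator_def)
  finally have m_eq: "maximal_function M \<F> g x = ennreal (m x)" for x
    by (simp add: m_def)
  have [measurable]: "m \<in> borel_measurable M"
    unfolding m_def using \<F>(1) by measurable
  have m0: "0 \<le> m x" for x by (simp add: m_def)
  define X where "X = (\<integral>\<^sup>+x. ennreal_powr (maximal_function M \<F> g x) q \<partial>M)"
  define Y where "Y = (\<integral>\<^sup>+x. ennreal_powr (g x) q \<partial>M)"
  \<comment> \<open>With this parameter Young's inequality leaves exactly half of \<open>X\<close> to be absorbed.\<close>
  define K where "K = 2 * q / (q - 1)"
  have K: "0 < K" using q by (simp add: K_def)
  have "X = (\<integral>\<^sup>+x. ennreal (m x powr q) \<partial>M)"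
    using m0 by (simp add: X_def m_eq)
  also have "\<dots> \<le> ennreal (q / (q - 1)) * (\<integral>\<^sup>+x. g x * ennreal (m x powr (q - 1)) \<partial>M)"
  proof (rule nn_integral_powr_le_of_weak_type[OF M q])
    fix l :: real assume "0 < l"
    then have "{x \<in> space M. l < m x} = {x \<in> space M. ennreal l < maximal_function M \<F> g x}"
      using m0 by (auto simp: m_eq ennreal_less_iff)
    then show "ennreal l * emeasure M {x \<in> space M. l < m x}
        \<le> (\<integral>\<^sup>+x\<in>{x \<in> space M. l < m x}. g x \<partial>M)"
      using maximal_function_weak_type[OF \<F> g, of "ennreal l"] by simp
  qed (use m0 in auto)
  also have "(\<integral>\<^sup>+x. g x * ennreal (m x powr (q - 1)) \<partial>M)
      \<le> (\<integral>\<^sup>+x. ennreal (K powr (q - 1)) * ennreal_powr (g x) q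
          + ennreal (1 / K) * ennreal_powr (maximal_function M \<F> g x) q \<partial>M)"
    using young_ennreal[OF q K, of "g _" "ennreal (m _)"] m0
    by (intro nn_integral_mono) (simp add: m_eq)
  also have "\<dots> = ennreal (K powr (q - 1)) * Y + ennreal (1 / K) * X"
    unfolding X_def Y_def using \<F>(1)
    by (subst nn_integral_add) (auto simp: nn_integral_cmult)
  finally have "X \<le> ennreal (q / (q - 1)) * (ennreal (K powr (q - 1)) * Y + ennreal (1 / K) * X)"
    by (simp add: mult_left_mono)
  also have "\<dots> = ennreal (q / (q - 1) * K powr (q - 1)) * Y + ennreal (q / (q - 1) * (1 / K)) * X"
    using q K by (simp add: distrib_left mult.assoc[symmetric] ennreal_mult[symmetric])
  also have "q / (q - 1) * (1 / K) = 1 / 2" using q by (simp add: K_def)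
  finally have "X \<le> ennreal (q / (q - 1) * K powr (q - 1)) * Y + ennreal (1 / 2) * X" .
  moreover have "X < \<infinity>"
  proof -
    have \<F>_sets: "finite \<F>" "\<F> \<subseteq> sets M" using \<F>(1) by (auto simp: averaging_family_def)
    then have sets: "\<Union>\<F> \<in> sets M" by (rule sets.finite_Union)
    have "emeasure M (\<Union>\<F>) \<le> sum (emeasure M) \<F>"
      using emeasure_subadditive_finite[of \<F> id M] \<F>_sets by simp
    also have "\<dots> < \<infinity>" using \<F>(1) by (simp add: averaging_family_def)
    finally have fin: "emeasure M (\<Union>\<F>) < \<infinity>" .
    have "X \<le> (\<integral>\<^sup>+x. ennreal_powr (ennreal B) q * indicator (\<Union>\<F>) x \<partial>M)"
    proof -
      have "ennreal_powr (maximal_function M \<F> g x) q \<le> ennreal_powr (ennreal B) q * indicator (\<Union>\<F>) x" for x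
      proof -
        have "ennreal_powr (maximal_function M \<F> g x) q \<le> ennreal_powr (ennreal B * indicator (\<Union>\<F>) x) q"
          using q by (intro ennreal_powr_mono le_B) simp
        then show ?thesis by (cases "x \<in> \<Union>\<F>") (simp_all del: Union_iff)
      qed
      then show ?thesis unfolding X_def by (rule nn_integral_mono)
    qed
    also have "\<dots> = ennreal_powr (ennreal B) q * emeasure M (\<Union>\<F>)"
      using sets by (rule nn_integral_cmult_indicator)
    also have "\<dots> < \<infinity>"
      using fin by (auto simp: ennreal_mult_less_top ennreal_powr_def)
    finally show ?thesis .
  qed
  ultimately have "X \<le> 2 * (ennreal (q / (q - 1) * K powr (q - 1)) * Y)"
    by (rule ennreal_absorb_half)
  also have "\<dots> = ennreal (K * K powr (q - 1)) * Y"
    using q by (simp add: K_def ennreal_mult mult.assoc[symmetric] ennreal_mult'[symmetric] flip: ennreal_numeral)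
  also have "K * K powr (q - 1) = maximal_const q"
    using K powr_mult_base[of K "q - 1"] unfolding maximal_const_def K_def[symmetric] by simp
  finally show ?thesis by (simp add: X_def Y_def)
qed


section \<open>The strong maximal function\<close>

definition rectangles :: "'a set set \<Rightarrow> 'b set set \<Rightarrow> ('a \<times> 'b) set set" where
  "rectangles \<F>1 \<F>2 = (\<lambda>(Q1, Q2). Q1 \<times> Q2) ` (\<F>1 \<times> \<F>2)"

lemma averaging_family_rectangles:
  assumes "sigma_finite_measure M2" "averaging_family M1 \<F>1" "averaging_family M2 \<F>2"
  shows "averaging_family (M1 \<Otimes>\<^sub>M M2) (rectangles \<F>1 \<F>2)"
  unfolding averaging_family_def
proof (intro conjI ballI)
  interpret M2: sigma_finite_measure M2 by (rule assms(1))
  show "finite (rectangles \<F>1 \<F>2)"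
    using assms by (auto simp: rectangles_def averaging_family_def)
  fix R assume "R \<in> rectangles \<F>1 \<F>2"
  then obtain Q1 Q2 where R: "R = Q1 \<times> Q2" "Q1 \<in> \<F>1" "Q2 \<in> \<F>2"
    by (auto simp: rectangles_def)
  then have Q: "Q1 \<in> sets M1" "Q2 \<in> sets M2" "0 < emeasure M1 Q1" "emeasure M1 Q1 < \<infinity>"
    "0 < emeasure M2 Q2" "emeasure M2 Q2 < \<infinity>"
    using assms by (auto simp: averaging_family_def)
  then have "emeasure (M1 \<Otimes>\<^sub>M M2) R = emeasure M1 Q1 * emeasure M2 Q2"
    unfolding R by (intro M2.emeasure_pair_measure_Times)
  then show "0 < emeasure (M1 \<Otimes>\<^sub>M M2) R" "emeasure (M1 \<Otimes>\<^sub>M M2) R < \<infinity>"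
    using Q by (auto simp: ennreal_zero_less_mult_iff ennreal_mult_less_top)
  show "R \<in> sets (M1 \<Otimes>\<^sub>M M2)" using R Q by simp
qed

text \<open>A mean over a rectangle is an iterated mean, so the maximal function over rectangles is dominated
  by the composition of the maximal functions in the two variables.\<close>

lemma maximal_function_rectangles_le_iterated:
  assumes M: "sigma_finite_measure M1" "sigma_finite_measure M2"
    and \<F>: "averaging_family M1 \<F>1" "averaging_family M2 \<F>2"
    and g [measurable]: "g \<in> borel_measurable (M1 \<Otimes>\<^sub>M M2)"
  shows "maximal_function (M1 \<Otimes>\<^sub>M M2) (rectangles \<F>1 \<F>2) g (x, y)
    \<le> maximal_function M1 \<F>1 (\<lambda>x'. maximal_function M2 \<F>2 (\<lambda>y'. g (x', y')) y) x"
  unfolding maximal_function_def[of "M1 \<Otimes>\<^sub>M M2"]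
proof (rule SUP_least)
  interpret M2: sigma_finite_measure M2 by (rule M(2))
  fix R assume "R \<in> rectangles \<F>1 \<F>2"
  then obtain Q1 Q2 where R: "R = Q1 \<times> Q2" "Q1 \<in> \<F>1" "Q2 \<in> \<F>2"
    by (auto simp: rectangles_def)
  then have [measurable]: "Q1 \<in> sets M1" "Q2 \<in> sets M2"
    and Q: "0 < emeasure M1 Q1" "emeasure M1 Q1 < \<infinity>" "0 < emeasure M2 Q2" "emeasure M2 Q2 < \<infinity>"
    using \<F> by (auto simp: averaging_family_def)
  show "mean (M1 \<Otimes>\<^sub>M M2) R g * indicator R (x, y)
      \<le> maximal_function M1 \<F>1 (\<lambda>x'. maximal_function M2 \<F>2 (\<lambda>y'. g (x', y')) y) x"
  proof (cases "(x, y) \<in> R")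
    case True
    have "(\<integral>\<^sup>+z\<in>R. g z \<partial>(M1 \<Otimes>\<^sub>M M2)) = (\<integral>\<^sup>+x'. \<integral>\<^sup>+y'. g (x', y') * indicator R (x', y') \<partial>M2 \<partial>M1)"
      unfolding R by (intro M2.nn_integral_fst[symmetric]) measurable
    also have "\<dots> = (\<integral>\<^sup>+x'. (\<integral>\<^sup>+y'\<in>Q2. g (x', y') \<partial>M2) * indicator Q1 x' \<partial>M1)"
      unfolding R by (intro nn_integral_cong) (auto simp: indicator_def)
    also have "\<dots> = (\<integral>\<^sup>+x'. (mean M2 Q2 (\<lambda>y'. g (x', y')) * indicator Q1 x') * emeasure M2 Q2 \<partial>M1)"
      using mean_times_measure[OF Q(3,4)] by (intro nn_integral_cong) (simp add: ac_simps)
    also have "\<dots> = (\<integral>\<^sup>+x'\<in>Q1. mean M2 Q2 (\<lambda>y'. g (x', y')) \<partial>M1) * emeasure M2 Q2"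
      unfolding mean_def by (rule nn_integral_multc) measurable
    also have "\<dots> = mean M1 Q1 (\<lambda>x'. mean M2 Q2 (\<lambda>y'. g (x', y'))) * (emeasure M1 Q1 * emeasure M2 Q2)"
      using mean_times_measure[OF Q(1,2)] by (simp add: mult.assoc[symmetric])
    finally have "mean (M1 \<Otimes>\<^sub>M M2) R g = mean M1 Q1 (\<lambda>x'. mean M2 Q2 (\<lambda>y'. g (x', y')))"
      unfolding mean_def[of "M1 \<Otimes>\<^sub>M M2"] using Q
      by (simp add: R M2.emeasure_pair_measure_Times mult_divide_eq_ennreal ennreal_mult_eq_top_iff
          zero_less_iff_neq_zero less_top[symmetric])
    also have "\<dots> \<le> mean M1 Q1 (\<lambda>x'. maximal_function M2 \<F>2 (\<lambda>y'. g (x', y')) y)"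
      using True R by (intro mean_mono mean_le_maximal_function) auto
    also have "\<dots> \<le> maximal_function M1 \<F>1 (\<lambda>x'. maximal_function M2 \<F>2 (\<lambda>y'. g (x', y')) y) x"
      using True R by (intro mean_le_maximal_function) auto
    finally show ?thesis using True by simp
  qed simp
qed

lemma maximal_function_rectangles_strong_type:
  assumes M: "sigma_finite_measure M1" "sigma_finite_measure M2"
    and \<F>1: "averaging_family M1 \<F>1" "nested \<F>1" and \<F>2: "averaging_family M2 \<F>2" "nested \<F>2"
    and q: "1 < q" and g [measurable]: "g \<in> borel_measurable (M1 \<Otimes>\<^sub>M M2)"
    and bound: "\<And>z. g z \<le> ennreal B"
  shows "(\<integral>\<^sup>+z. ennreal_powr (maximal_function (M1 \<Otimes>\<^sub>M M2) (rectangles \<F>1 \<F>2) g z) q \<partial>(M1 \<Otimes>\<^sub>M M2))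
    \<le> ennreal ((maximal_const q)\<^sup>2) * (\<integral>\<^sup>+z. ennreal_powr (g z) q \<partial>(M1 \<Otimes>\<^sub>M M2))"
proof -
  interpret M1: sigma_finite_measure M1 by (rule M(1))
  interpret M2: sigma_finite_measure M2 by (rule M(2))
  interpret P: pair_sigma_finite M1 M2 ..
  have fin: "finite \<F>1" "finite \<F>2" and [measurable]: "\<And>Q. Q \<in> \<F>1 \<Longrightarrow> Q \<in> sets M1" "\<And>Q. Q \<in> \<F>2 \<Longrightarrow> Q \<in> sets M2"
    using \<F>1 \<F>2 by (auto simp: averaging_family_def)
  define G where "G = (\<lambda>x y. maximal_function M2 \<F>2 (\<lambda>y'. g (x, y')) y)"
  define H where "H = (\<lambda>x y. maximal_function M1 \<F>1 (\<lambda>x'. G x' y) x)"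
  have G [measurable]: "case_prod G \<in> borel_measurable (M1 \<Otimes>\<^sub>M M2)"
    unfolding G_def maximal_function_def mean_def case_prod_beta
  proof (intro borel_measurable_SUP)
    fix Q assume [measurable]: "Q \<in> \<F>2"
    show "(\<lambda>z. (\<integral>\<^sup>+y'\<in>Q. g (fst z, y') \<partial>M2) / emeasure M2 Q * indicator Q (snd z))
        \<in> borel_measurable (M1 \<Otimes>\<^sub>M M2)" by measurable
  qed (use fin in \<open>simp add: countable_finite\<close>)
  have H [measurable]: "case_prod H \<in> borel_measurable (M1 \<Otimes>\<^sub>M M2)"
    unfolding H_def maximal_function_def mean_def case_prod_beta
  proof (intro borel_measurable_SUP)
    fix Q assume [measurable]: "Q \<in> \<F>1"
    show "(\<lambda>z. (\<integral>\<^sup>+x'\<in>Q. G x' (snd z) \<partial>M1) / emeasure M1 Q * indicator Q (fst z))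
        \<in> borel_measurable (M1 \<Otimes>\<^sub>M M2)" by measurable
  qed (use fin in \<open>simp add: countable_finite\<close>)
  have G_bound: "G x y \<le> ennreal B" for x y
    using maximal_function_le_bound[OF \<F>2(1) bound, of "\<lambda>y'. (x, y')" y]
    by (cases "y \<in> \<Union>\<F>2") (simp_all add: G_def del: Union_iff)
  have "(\<integral>\<^sup>+z. ennreal_powr (maximal_function (M1 \<Otimes>\<^sub>M M2) (rectangles \<F>1 \<F>2) g z) q \<partial>(M1 \<Otimes>\<^sub>M M2))
      \<le> (\<integral>\<^sup>+z. ennreal_powr (case_prod H z) q \<partial>(M1 \<Otimes>\<^sub>M M2))"
    using maximal_function_rectangles_le_iterated[OF M \<F>1(1) \<F>2(1) g] q
    by (intro nn_integral_mono ennreal_powr_mono) (auto simp: H_def G_def)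
  also have "\<dots> = (\<integral>\<^sup>+y. \<integral>\<^sup>+x. ennreal_powr (H x y) q \<partial>M1 \<partial>M2)"
    by (subst P.nn_integral_snd[symmetric]) auto
  also have "\<dots> \<le> (\<integral>\<^sup>+y. ennreal (maximal_const q) * (\<integral>\<^sup>+x. ennreal_powr (G x y) q \<partial>M1) \<partial>M2)"
    unfolding H_def using M(1) \<F>1 q G_bound
    by (intro nn_integral_mono maximal_function_strong_type) auto
  also have "\<dots> = ennreal (maximal_const q) * (\<integral>\<^sup>+y. \<integral>\<^sup>+x. ennreal_powr (G x y) q \<partial>M1 \<partial>M2)"
    by (rule nn_integral_cmult) measurable
  also have "(\<integral>\<^sup>+y. \<integral>\<^sup>+x. ennreal_powr (G x y) q \<partial>M1 \<partial>M2) = (\<integral>\<^sup>+x. \<integral>\<^sup>+y. ennreal_powr (G x y) q \<partial>M2 \<partial>M1)"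
    by (rule P.Fubini') measurable
  also have "\<dots> \<le> (\<integral>\<^sup>+x. ennreal (maximal_const q) * (\<integral>\<^sup>+y. ennreal_powr (g (x, y)) q \<partial>M2) \<partial>M1)"
    unfolding G_def using M(2) \<F>2 q bound
    by (intro nn_integral_mono maximal_function_strong_type) auto
  also have "\<dots> = ennreal (maximal_const q) * (\<integral>\<^sup>+x. \<integral>\<^sup>+y. ennreal_powr (g (x, y)) q \<partial>M2 \<partial>M1)"
    by (rule nn_integral_cmult) measurable
  also have "(\<integral>\<^sup>+x. \<integral>\<^sup>+y. ennreal_powr (g (x, y)) q \<partial>M2 \<partial>M1) = (\<integral>\<^sup>+z. ennreal_powr (g z) q \<partial>(M1 \<Otimes>\<^sub>M M2))"
    by (rule M2.nn_integral_fst) measurable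
  finally show ?thesis
    by (simp add: mult_left_mono power2_eq_square ennreal_mult maximal_const_def mult.assoc)
qed


section \<open>Replacing sets by large subsets\<close>

definition weighted_count :: "('i \<Rightarrow> real) \<Rightarrow> ('i \<Rightarrow> 'a set) \<Rightarrow> 'i set \<Rightarrow> 'a \<Rightarrow> ennreal" where
  "weighted_count b R I x = (\<Sum>i\<in>I. ennreal (b i) * indicator (R i) x)"

lemma measurable_weighted_count [measurable]:
  assumes [measurable]: "\<And>i. i \<in> I \<Longrightarrow> R i \<in> sets M"
  shows "weighted_count b R I \<in> borel_measurable M"
  unfolding weighted_count_def[abs_def] by measurable

lemma weighted_count_le: "weighted_count b R I x \<le> ennreal (\<Sum>i\<in>I. \<bar>b i\<bar>)"
proof -
  have "weighted_count b R I x \<le> (\<Sum>i\<in>I. ennreal \<bar>b i\<bar>)"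
    unfolding weighted_count_def by (intro sum_mono) (auto simp: indicator_def intro: ennreal_leI)
  then show ?thesis by (simp add: sum_ennreal)
qed

lemma nn_integral_weighted_count_mult:
  assumes [measurable]: "\<And>i. i \<in> I \<Longrightarrow> R i \<in> sets M" "h \<in> borel_measurable M"
  shows "(\<integral>\<^sup>+x. weighted_count b R I x * h x \<partial>M) = (\<Sum>i\<in>I. ennreal (b i) * (\<integral>\<^sup>+x\<in>R i. h x \<partial>M))"
proof -
  have "(\<integral>\<^sup>+x. weighted_count b R I x * h x \<partial>M)
      = (\<integral>\<^sup>+x. (\<Sum>i\<in>I. ennreal (b i) * (h x * indicator (R i) x)) \<partial>M)"
    by (simp add: weighted_count_def sum_distrib_left sum_distrib_right ac_simps)
  also have "\<dots> = (\<Sum>i\<in>I. \<integral>\<^sup>+x. ennreal (b i) * (h x * indicator (R i) x) \<partial>M)"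
    by (rule nn_integral_sum) measurable
  also have "\<dots> = (\<Sum>i\<in>I. ennreal (b i) * (\<integral>\<^sup>+x\<in>R i. h x \<partial>M))"
    by (intro sum.cong refl nn_integral_cmult) measurable
  finally show ?thesis .
qed

text \<open>Bounded functions are all that the comparison below feeds into the maximal function; over a finite
  family their maximal functions have finite norm, as the absorption argument requires.\<close>

definition maximal_bound :: "'a measure \<Rightarrow> 'a set set \<Rightarrow> real \<Rightarrow> real \<Rightarrow> bool" where
  "maximal_bound M \<F> q A \<longleftrightarrow> (\<forall>g B. g \<in> borel_measurable M \<longrightarrow> (\<forall>x. g x \<le> ennreal B) \<longrightarrow>
     (\<integral>\<^sup>+x. ennreal_powr (maximal_function M \<F> g x) q \<partial>M) \<le> ennreal A * (\<integral>\<^sup>+x. ennreal_powr (g x) q \<partial>M))"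

text \<open>With \<open>F = \<Sum> b 1\<^sub>R\<close> and \<open>G = \<Sum> b 1\<^sub>E\<close>, test \<open>F\<close> against \<open>h = F\<^bsup>t-1\<^esup>\<close>: the integral of \<open>h\<close> over \<open>R\<close> is at most
  twice the integral over \<open>E\<close> of its maximal function \<open>m\<close>. Hence \<open>\<integral>F\<^sup>t \<le> 2 \<integral>G m\<close>, and Young's inequality
  together with the maximal bound in the dual exponent \<open>t / (t - 1)\<close> absorbs \<open>m\<close> into the left side.\<close>

lemma shrink_sets_exponent_gt_one:
  assumes t: "1 < t" and I: "finite I" and fam: "averaging_family M (R ` I)"
    and E: "\<And>i. i \<in> I \<Longrightarrow> E i \<in> sets M" "\<And>i. i \<in> I \<Longrightarrow> E i \<subseteq> R i"
      "\<And>i. i \<in> I \<Longrightarrow> emeasure M (R i) \<le> 2 * emeasure M (E i)"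
    and A: "maximal_bound M (R ` I) (t / (t - 1)) A" "0 < A"
  shows "(\<integral>\<^sup>+x. ennreal_powr (weighted_count b R I x) t \<partial>M)
    \<le> ennreal (4 * (4 * A) powr (t - 1)) * (\<integral>\<^sup>+x. ennreal_powr (weighted_count b E I x) t \<partial>M)"
proof -
  let ?F = "weighted_count b R I" and ?G = "weighted_count b E I"
  have R [measurable]: "R i \<in> sets M" and Rpos: "0 < emeasure M (R i)" "emeasure M (R i) < \<infinity>"
    if "i \<in> I" for i using fam that by (auto simp: averaging_family_def)
  note E(1) [measurable]
  define h where "h = (\<lambda>x. ennreal_powr (?F x) (t - 1))"
  define m where "m = maximal_function M (R ` I) h"
  have h [measurable]: "h \<in> borel_measurable M" unfolding h_def by measurable
  have m [measurable]: "m \<in> borel_measurable M" unfolding m_def using fam by measurable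
  define B where "B = (\<Sum>i\<in>I. \<bar>b i\<bar>)"
  have B: "0 \<le> B" by (simp add: B_def sum_nonneg)
  have h_bound: "h x \<le> ennreal (B powr (t - 1))" for x
    unfolding h_def B_def using ennreal_powr_mono[OF _ weighted_count_le, of "t - 1" b R I x] t
    by (simp add: sum_nonneg)
  define X where "X = (\<integral>\<^sup>+x. ennreal_powr (?F x) t \<partial>M)"
  define Y where "Y = (\<integral>\<^sup>+x. ennreal_powr (?G x) t \<partial>M)"
  have split: "ennreal_powr y t = y * ennreal_powr y (t - 1)" for y
    using t by (cases y) (simp_all add: ennreal_mult[symmetric] powr_mult_base)
  \<comment> \<open>Young's inequality is used with parameter \<open>4 A\<close>: the factors \<open>2\<close> from shrinking and \<open>A\<close> from the
    maximal bound then leave half of \<open>X\<close> to be absorbed.\<close>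
  have "X = (\<integral>\<^sup>+x. ?F x * h x \<partial>M)" by (simp add: X_def h_def split)
  also have "\<dots> = (\<Sum>i\<in>I. ennreal (b i) * (\<integral>\<^sup>+x\<in>R i. h x \<partial>M))"
    by (rule nn_integral_weighted_count_mult) measurable
  also have "\<dots> \<le> (\<Sum>i\<in>I. ennreal (b i) * (2 * (\<integral>\<^sup>+x\<in>E i. m x \<partial>M)))"
  proof (intro sum_mono mult_left_mono)
    fix i assume i: "i \<in> I"
    have "(\<integral>\<^sup>+x\<in>R i. h x \<partial>M) = mean M (R i) h * emeasure M (R i)"
      using Rpos[OF i] by (simp add: mean_times_measure)
    also have "\<dots> \<le> mean M (R i) h * (2 * emeasure M (E i))"
      by (intro mult_left_mono E(3) i) auto
    also have "\<dots> = 2 * (\<integral>\<^sup>+x. mean M (R i) h * indicator (E i) x \<partial>M)"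
      using i by (simp add: nn_integral_cmult_indicator mult.left_commute)
    also have "\<dots> \<le> 2 * (\<integral>\<^sup>+x\<in>E i. m x \<partial>M)"
    proof (intro mult_left_mono nn_integral_mono)
      fix x
      show "mean M (R i) h * indicator (E i) x \<le> m x * indicator (E i) x"
        using i E(2)[OF i] mean_le_maximal_function[of "R i" "R ` I" x M h]
        by (cases "x \<in> E i") (auto simp: m_def)
    qed auto
    finally show "(\<integral>\<^sup>+x\<in>R i. h x \<partial>M) \<le> 2 * (\<integral>\<^sup>+x\<in>E i. m x \<partial>M)" .
  qed auto
  also have "\<dots> = 2 * (\<integral>\<^sup>+x. ?G x * m x \<partial>M)"
    by (subst nn_integral_weighted_count_mult) (auto simp: sum_distrib_left ac_simps)
  also have "(\<integral>\<^sup>+x. ?G x * m x \<partial>M) \<le> (\<integral>\<^sup>+x. ennreal ((4 * A) powr (t - 1)) * ennreal_powr (?G x) t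
      + ennreal (1 / (4 * A)) * ennreal_powr (m x) (t / (t - 1)) \<partial>M)"
    using young_ennreal[OF t, of "4 * A" "?G _" "ennreal_powr (m _) (1 / (t - 1))"] t A(2)
    by (intro nn_integral_mono) (simp add: ennreal_powr_powr)
  also have "\<dots> = ennreal ((4 * A) powr (t - 1)) * Y
      + ennreal (1 / (4 * A)) * (\<integral>\<^sup>+x. ennreal_powr (m x) (t / (t - 1)) \<partial>M)"
    unfolding Y_def by (subst nn_integral_add) (auto simp: nn_integral_cmult)
  also have "(\<integral>\<^sup>+x. ennreal_powr (m x) (t / (t - 1)) \<partial>M) \<le> ennreal A * (\<integral>\<^sup>+x. ennreal_powr (h x) (t / (t - 1)) \<partial>M)"
    using A(1) h h_bound unfolding maximal_bound_def m_def by blast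
  also have "(\<integral>\<^sup>+x. ennreal_powr (h x) (t / (t - 1)) \<partial>M) = X"
    using t by (simp add: h_def X_def ennreal_powr_powr)
  finally have "X \<le> 2 * (ennreal ((4 * A) powr (t - 1)) * Y + ennreal (1 / (4 * A)) * (ennreal A * X))"
    by (simp add: mult_left_mono add_left_mono)
  also have "\<dots> = ennreal (2 * (4 * A) powr (t - 1)) * Y + ennreal (1 / 2) * X"
    using A(2) by (simp add: distrib_left mult.assoc[symmetric] ennreal_mult[symmetric] ennreal_mult'[symmetric]
        flip: ennreal_numeral)
  finally have "X \<le> ennreal (2 * (4 * A) powr (t - 1)) * Y + ennreal (1 / 2) * X" .
  moreover have "X < \<infinity>"
  proof -
    have "\<Union>(R ` I) \<in> sets M" using I R by blast
    have "X \<le> (\<integral>\<^sup>+x. ennreal (B powr t) * indicator (\<Union>(R ` I)) x \<partial>M)"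
    proof -
      have "ennreal_powr (?F x) t \<le> ennreal (B powr t) * indicator (\<Union>(R ` I)) x" for x
      proof (cases "x \<in> \<Union>(R ` I)")
        case True
        then show ?thesis
          using ennreal_powr_mono[OF _ weighted_count_le, of t b R I x] t B by (simp add: B_def)
      next
        case False
        then have "?F x = 0" by (auto simp: weighted_count_def indicator_def)
        then show ?thesis by simp
      qed
      then show ?thesis unfolding X_def by (rule nn_integral_mono)
    qed
    also have "\<dots> = ennreal (B powr t) * emeasure M (\<Union>(R ` I))"
      using \<open>\<Union>(R ` I) \<in> sets M\<close> by (rule nn_integral_cmult_indicator)
    also have "emeasure M (\<Union>(R ` I)) \<le> (\<Sum>i\<in>I. emeasure M (R i))"
      using I R by (intro emeasure_subadditive_finite) auto
    also have "ennreal (B powr t) * (\<Sum>i\<in>I. emeasure M (R i)) < \<infinity>"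
      using Rpos I by (auto simp: ennreal_mult_less_top)
    finally show ?thesis by (simp add: mult_left_mono)
  qed
  ultimately have "X \<le> 2 * (ennreal (2 * (4 * A) powr (t - 1)) * Y)"
    by (rule ennreal_absorb_half)
  also have "\<dots> = ennreal (4 * (4 * A) powr (t - 1)) * Y"
    by (simp add: mult.assoc[symmetric] ennreal_mult'[symmetric] flip: ennreal_numeral)
  finally show ?thesis by (simp add: X_def Y_def)
qed

text \<open>Below exponent one there is no duality; instead \<open>F\<^sup>t \<le> F u\<^bsup>t-1\<^esup> + u\<^sup>t\<close> for every \<open>u > 0\<close>. Take \<open>u = m\<^bsup>2/t\<^esup>\<close>, where
  \<open>m\<close> is the maximal function of \<open>G\<^bsup>t/2\<^esup>\<close>. The second term is handled by the \<open>L\<^sup>2\<close> bound. In the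
  first, \<open>u\<^bsup>t-1\<^esup> = m\<^bsup>-\<kappa>\<^esup>\<close> is on \<open>R\<close> at most \<open>c\<^bsup>-\<kappa>\<^esup>\<close> with \<open>c\<close> the mean of \<open>G\<^bsup>t/2\<^esup>\<close>, and this is at most
  a constant times the mean over \<open>E\<close> of \<open>G\<^bsup>t-1\<^esup>\<close>, a form of Jensen's inequality; summing over \<open>R\<close> rebuilds
  \<open>\<integral>G G\<^bsup>t-1\<^esup>\<close>.\<close>

lemma shrink_sets_exponent_le_one:
  assumes t: "0 < t" "t \<le> 1" and I: "finite I" and fam: "averaging_family M (R ` I)"
    and b: "\<And>i. i \<in> I \<Longrightarrow> 0 < b i"
    and E: "\<And>i. i \<in> I \<Longrightarrow> E i \<in> sets M" "\<And>i. i \<in> I \<Longrightarrow> E i \<subseteq> R i"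
      "\<And>i. i \<in> I \<Longrightarrow> emeasure M (R i) \<le> 2 * emeasure M (E i)"
    and A: "maximal_bound M (R ` I) 2 A" "0 \<le> A"
  shows "(\<integral>\<^sup>+x. ennreal_powr (weighted_count b R I x) t \<partial>M)
    \<le> ennreal (4 powr (1 + 2 * (1 - t) / t) + A) * (\<integral>\<^sup>+x. ennreal_powr (weighted_count b E I x) t \<partial>M)"
proof -
  have R [measurable]: "R i \<in> sets M" and Rpos: "0 < emeasure M (R i)" "emeasure M (R i) < \<infinity>"
    if "i \<in> I" for i using fam that by (auto simp: averaging_family_def)
  note E(1) [measurable]
  define \<kappa> where "\<kappa> = 2 * (1 - t) / t"
  have \<kappa>: "0 \<le> \<kappa>" using t by (simp add: \<kappa>_def)
  have t\<kappa>: "t / 2 * - \<kappa> = t - 1" "2 / t * (t - 1) = - \<kappa>"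
    using t by (simp_all add: \<kappa>_def field_simps)
  define F where "F = (\<lambda>x. \<Sum>i\<in>I. b i * indicator (R i) x)"
  define G where "G = (\<lambda>x. \<Sum>i\<in>I. b i * indicator (E i) x)"
  have b0: "0 \<le> b i" if "i \<in> I" for i using b[OF that] by simp
  have F0: "0 \<le> F x" and G0: "0 \<le> G x" for x
    unfolding F_def G_def using b0 by (auto intro!: sum_nonneg)
  have F: "weighted_count b R I x = ennreal (F x)" and G: "weighted_count b E I x = ennreal (G x)" for x
    unfolding weighted_count_def F_def G_def using b0
    by (simp_all add: sum_ennreal[symmetric] ennreal_mult flip: ennreal_indicator)
  have [measurable]: "F \<in> borel_measurable M" "G \<in> borel_measurable M"
    unfolding F_def G_def by measurable
  have G_ge: "b i \<le> G x" if "i \<in> I" "x \<in> E i" for i x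
    using member_le_sum[of i I "\<lambda>i. b i * indicator (E i) x"] that b0 I by (simp add: G_def)
  define g where "g = (\<lambda>x. G x powr (t / 2))"
  define h where "h = (\<lambda>x. ennreal (g x))"
  have [measurable]: "g \<in> borel_measurable M" "h \<in> borel_measurable M"
    unfolding g_def h_def by measurable
  have h_bound: "h x \<le> ennreal ((\<Sum>i\<in>I. \<bar>b i\<bar>) powr (t / 2))" for x
    unfolding h_def g_def using ennreal_powr_mono[OF _ weighted_count_le, of "t / 2" b E I x] t G0
    by (simp add: G sum_nonneg)
  define m where "m = (\<lambda>x. enn2real (maximal_function M (R ` I) h x))"
  have m0: "0 \<le> m x" for x by (simp add: m_def)
  have m: "maximal_function M (R ` I) h x = ennreal (m x)" for x
  proof -
    note maximal_function_le_bound[OF fam h_bound, where x = x]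
    also have "ennreal ((\<Sum>i\<in>I. \<bar>b i\<bar>) powr (t / 2)) * indicator (\<Union>(R ` I)) x < top"
      by (simp add: ennreal_mult_less_top indicator_def)
    finally show ?thesis by (simp add: m_def)
  qed
  have [measurable]: "m \<in> borel_measurable M" unfolding m_def using fam by measurable

  have key: "\<exists>c>0. (\<forall>x\<in>R i. c \<le> m x) \<and> ennreal (c powr - \<kappa>) * emeasure M (R i)
      \<le> ennreal (4 powr (1 + \<kappa>)) * (\<integral>\<^sup>+x\<in>E i. ennreal (G x powr (t - 1)) \<partial>M)" if i: "i \<in> I" for i
  proof -
    obtain r where r: "0 < r" "emeasure M (R i) = ennreal r"
      using Rpos[OF i] by (cases "emeasure M (R i)") auto
    have "emeasure M (E i) \<le> emeasure M (R i)" using i E(2) by (intro emeasure_mono) auto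
    then obtain e where e: "0 \<le> e" "emeasure M (E i) = ennreal e"
      using r by (cases "emeasure M (E i)") (auto simp: top_unique)
    have re: "r \<le> 2 * e"
      using E(3)[OF i] r e by (simp add: ennreal_mult'[symmetric] flip: ennreal_numeral)
    have int_h: "ennreal (b i powr (t / 2)) * ennreal e \<le> (\<integral>\<^sup>+x\<in>E i. h x \<partial>M)"
    proof -
      have "ennreal (b i powr (t / 2)) * ennreal e = (\<integral>\<^sup>+x. ennreal (b i powr (t / 2)) * indicator (E i) x \<partial>M)"
        using i e by (simp add: nn_integral_cmult_indicator)
      also have "\<dots> \<le> (\<integral>\<^sup>+x\<in>E i. h x \<partial>M)"
        using G_ge[OF i] b0[OF i] t
        by (intro nn_integral_mono) (auto simp: indicator_def h_def g_def intro!: ennreal_leI powr_mono2)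
      finally show ?thesis .
    qed
    have int_h': "(\<integral>\<^sup>+x\<in>E i. h x \<partial>M) \<le> mean M (R i) h * ennreal r"
      unfolding r(2)[symmetric] mean_times_measure[OF Rpos[OF i]] using E(2)[OF i]
      by (intro nn_integral_mono) (auto simp: indicator_def)
    have "mean M (R i) h \<noteq> top"
      using mean_mono[of "R i" h "\<lambda>_. ennreal ((\<Sum>i\<in>I. \<bar>b i\<bar>) powr (t / 2))" M] h_bound
        mean_const[OF R[OF i] Rpos[OF i]] by (auto simp: top_unique)
    then obtain c where c: "0 \<le> c" "mean M (R i) h = ennreal c"
      by (cases "mean M (R i) h") auto
    have "0 < e" using re r by simp
    then have "ennreal 0 < ennreal (b i powr (t / 2) * e)" using b[OF i] by simp
    also have "\<dots> \<le> ennreal (c * r)"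
      using order_trans[OF int_h int_h'] c r e by (simp add: ennreal_mult)
    finally have "0 < c" using r c by (simp add: ennreal_less_iff zero_less_mult_iff)
    have cm: "c \<le> m x" if "x \<in> R i" for x
      using mean_le_maximal_function[of "R i" "R ` I" x M h] that i c m0 by (simp add: m)
    define a where "a = (4 * c) powr - \<kappa>"
    have a: "0 < a" using \<open>0 < c\<close> by (simp add: a_def)
    define J where "J = (\<integral>\<^sup>+x\<in>E i. ennreal (G x powr (t - 1)) \<partial>M)"
    \<comment> \<open>Where \<open>g\<close> is at most four times its mean, its negative power is controlled from below;
      the remaining points of \<open>R i\<close> are few by Markov's inequality.\<close>
    have pt: "a \<le> G x powr (t - 1) + a / (4 * c) * g x" if x: "x \<in> E i" for x
    proof (cases "g x \<le> 4 * c")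
      case True
      have Gx: "0 < G x" using G_ge[OF i x] b[OF i] by simp
      then have "0 < g x" by (simp add: g_def)
      then have "a \<le> g x powr - \<kappa>"
        unfolding a_def using True \<kappa> by (intro powr_mono2') auto
      also have "\<dots> = G x powr (t - 1)" by (simp only: g_def powr_powr t\<kappa>)
      also have "\<dots> \<le> G x powr (t - 1) + a / (4 * c) * g x"
        using a \<open>0 < c\<close> by (simp add: g_def)
      finally show ?thesis .
    next
      case False
      then have "a * 1 \<le> a * (g x / (4 * c))"
        using a \<open>0 < c\<close> by (intro mult_left_mono) (auto simp: field_simps)
      then show ?thesis by (simp add: add_increasing)
    qed
    have "ennreal (a * e) = (\<integral>\<^sup>+x. ennreal a * indicator (E i) x \<partial>M)"
      using i e a by (simp add: nn_integral_cmult_indicator ennreal_mult)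
    also have "\<dots> \<le> (\<integral>\<^sup>+x. ennreal (G x powr (t - 1)) * indicator (E i) x
        + ennreal (a / (4 * c)) * (h x * indicator (E i) x) \<partial>M)"
    proof (rule nn_integral_mono)
      fix x
      have "ennreal a \<le> ennreal (G x powr (t - 1)) + ennreal (a / (4 * c)) * h x" if "x \<in> E i"
        using ennreal_leI[OF pt[OF that]] a \<open>0 < c\<close>
        by (simp add: h_def g_def ennreal_mult[symmetric] ennreal_plus[symmetric] del: ennreal_plus)
      then show "ennreal a * indicator (E i) x \<le> ennreal (G x powr (t - 1)) * indicator (E i) x
          + ennreal (a / (4 * c)) * (h x * indicator (E i) x)"
        by (cases "x \<in> E i") simp_all
    qed
    also have "\<dots> = J + ennreal (a / (4 * c)) * (\<integral>\<^sup>+x\<in>E i. h x \<partial>M)"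
      unfolding J_def using i by (subst nn_integral_add) (auto simp: nn_integral_cmult)
    also have "\<dots> \<le> J + ennreal (a / (4 * c)) * (ennreal c * ennreal r)"
      using int_h' by (intro add_left_mono mult_left_mono) (auto simp: c)
    also have "\<dots> = J + ennreal (a * r / 4)"
      using \<open>0 < c\<close> a r by (simp add: ennreal_mult[symmetric])
    finally have J: "ennreal (a * e) \<le> J + ennreal (a * r / 4)" .
    have "ennreal (c powr - \<kappa> * r) \<le> ennreal (4 powr (1 + \<kappa>)) * J"
    proof (cases J)
      case (real j)
      then have "ennreal (a * e) \<le> ennreal (j + a * r / 4)"
        using J a r by simp
      then have "a * e \<le> j + a * r / 4"
        using real a r by (subst (asm) ennreal_le_iff) auto
      moreover have "a * r \<le> a * (2 * e)" using a re by (intro mult_left_mono) auto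
      ultimately have "a * r \<le> 4 * j" by simp
      moreover have "c powr - \<kappa> = 4 powr \<kappa> * a"
        using \<open>0 < c\<close> by (simp add: a_def powr_mult powr_minus field_simps)
      ultimately have "c powr - \<kappa> * r \<le> 4 powr \<kappa> * (4 * j)"
        by (simp add: mult.assoc)
      also have "\<dots> = 4 powr (1 + \<kappa>) * j" by (simp add: powr_add)
      finally show ?thesis using real by (simp add: ennreal_mult[symmetric] ennreal_leI)
    qed (simp add: ennreal_mult_top)
    then show ?thesis
      using \<open>0 < c\<close> cm r by (intro exI[of _ c]) (simp add: J_def ennreal_mult)
  qed
  from key have "\<forall>i\<in>I. \<exists>c. 0 < c \<and> (\<forall>x\<in>R i. c \<le> m x) \<and> ennreal (c powr - \<kappa>) * emeasure M (R i)
      \<le> ennreal (4 powr (1 + \<kappa>)) * (\<integral>\<^sup>+x\<in>E i. ennreal (G x powr (t - 1)) \<partial>M)" by blast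
  from bchoice[OF this] obtain c where c0: "\<And>i. i \<in> I \<Longrightarrow> 0 < c i" and cm: "\<And>i x. i \<in> I \<Longrightarrow> x \<in> R i \<Longrightarrow> c i \<le> m x"
    and c: "\<And>i. i \<in> I \<Longrightarrow> ennreal (c i powr - \<kappa>) * emeasure M (R i)
      \<le> ennreal (4 powr (1 + \<kappa>)) * (\<integral>\<^sup>+x\<in>E i. ennreal (G x powr (t - 1)) \<partial>M)"
    by blast
  have split: "F x powr t \<le> F x * m x powr - \<kappa> + (m x)\<^sup>2" for x
  proof (cases "F x = 0")
    case False
    have "\<exists>i\<in>I. x \<in> R i"
    proof (rule ccontr)
      assume "\<not> (\<exists>i\<in>I. x \<in> R i)"
      then have "F x = 0" unfolding F_def by (intro sum.neutral) auto
      then show False using False by simp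
    qed
    then obtain i where "i \<in> I" "x \<in> R i" by blast
    then have mx: "0 < m x" using c0 cm by force
    have Fx: "0 < F x" using False F0[of x] by simp
    show ?thesis
    proof (cases "F x \<le> m x powr (2 / t)")
      case True
      then have "F x powr t \<le> (m x powr (2 / t)) powr t" using t F0 by (intro powr_mono2) auto
      also have "\<dots> = (m x)\<^sup>2" using t mx by (simp add: powr_powr powr_numeral)
      finally show ?thesis using F0[of x] by (simp add: add_increasing)
    next
      case False
      have "F x powr t = F x * F x powr (t - 1)" using Fx by (simp add: powr_mult_base)
      also have "F x powr (t - 1) \<le> (m x powr (2 / t)) powr (t - 1)"
        using False t mx by (intro powr_mono2') auto
      also have "\<dots> = m x powr - \<kappa>" by (simp only: powr_powr t\<kappa>)
      finally show ?thesis using F0[of x] by (simp add: mult_left_mono add_increasing2)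
    qed
  qed (use t in simp)
  have "(\<integral>\<^sup>+x. ennreal (F x powr t) \<partial>M)
      \<le> (\<integral>\<^sup>+x. ennreal (F x) * ennreal (m x powr - \<kappa>) + ennreal ((m x)\<^sup>2) \<partial>M)"
    using split F0 by (intro nn_integral_mono)
      (simp add: ennreal_mult[symmetric] ennreal_plus[symmetric] ennreal_leI del: ennreal_plus)
  also have "\<dots> = (\<integral>\<^sup>+x. ennreal (F x) * ennreal (m x powr - \<kappa>) \<partial>M) + (\<integral>\<^sup>+x. ennreal ((m x)\<^sup>2) \<partial>M)"
    by (rule nn_integral_add) measurable
  also have "\<dots> \<le> ennreal (4 powr (1 + \<kappa>)) * (\<integral>\<^sup>+x. ennreal (G x powr t) \<partial>M)
      + ennreal A * (\<integral>\<^sup>+x. ennreal (G x powr t) \<partial>M)"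
  proof (rule add_mono)
    have "(\<integral>\<^sup>+x. ennreal (F x) * ennreal (m x powr - \<kappa>) \<partial>M)
        = (\<Sum>i\<in>I. ennreal (b i) * (\<integral>\<^sup>+x\<in>R i. ennreal (m x powr - \<kappa>) \<partial>M))"
      unfolding F[symmetric] by (rule nn_integral_weighted_count_mult) measurable
    also have "\<dots> \<le> (\<Sum>i\<in>I. ennreal (b i) * (ennreal (4 powr (1 + \<kappa>)) * (\<integral>\<^sup>+x\<in>E i. ennreal (G x powr (t - 1)) \<partial>M)))"
    proof (intro sum_mono mult_left_mono)
      fix i assume i: "i \<in> I"
      have "(\<integral>\<^sup>+x\<in>R i. ennreal (m x powr - \<kappa>) \<partial>M) \<le> (\<integral>\<^sup>+x. ennreal (c i powr - \<kappa>) * indicator (R i) x \<partial>M)"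
        using c0[OF i] cm[OF i] \<kappa>
        by (intro nn_integral_mono) (auto simp: indicator_def intro!: ennreal_leI powr_mono2')
      also have "\<dots> = ennreal (c i powr - \<kappa>) * emeasure M (R i)"
        using i by (simp add: nn_integral_cmult_indicator)
      also note c[OF i]
      finally show "(\<integral>\<^sup>+x\<in>R i. ennreal (m x powr - \<kappa>) \<partial>M)
        \<le> ennreal (4 powr (1 + \<kappa>)) * (\<integral>\<^sup>+x\<in>E i. ennreal (G x powr (t - 1)) \<partial>M)" .
    qed auto
    also have "\<dots> = ennreal (4 powr (1 + \<kappa>)) * (\<integral>\<^sup>+x. ennreal (G x) * ennreal (G x powr (t - 1)) \<partial>M)"
      unfolding G[symmetric]
      by (subst nn_integral_weighted_count_mult) (auto simp: sum_distrib_left ac_simps)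
    also have "(\<integral>\<^sup>+x. ennreal (G x) * ennreal (G x powr (t - 1)) \<partial>M) = (\<integral>\<^sup>+x. ennreal (G x powr t) \<partial>M)"
      using G0 by (simp add: ennreal_mult[symmetric] powr_mult_base)
    finally show "(\<integral>\<^sup>+x. ennreal (F x) * ennreal (m x powr - \<kappa>) \<partial>M)
      \<le> ennreal (4 powr (1 + \<kappa>)) * (\<integral>\<^sup>+x. ennreal (G x powr t) \<partial>M)" .
    have "(\<integral>\<^sup>+x. ennreal ((m x)\<^sup>2) \<partial>M) = (\<integral>\<^sup>+x. ennreal_powr (maximal_function M (R ` I) h x) 2 \<partial>M)"
      using m0 by (simp add: m powr_numeral)
    also have "\<dots> \<le> ennreal A * (\<integral>\<^sup>+x. ennreal_powr (h x) 2 \<partial>M)"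
      using A(1) h_bound \<open>h \<in> borel_measurable M\<close> unfolding maximal_bound_def by blast
    also have "(\<integral>\<^sup>+x. ennreal_powr (h x) 2 \<partial>M) = (\<integral>\<^sup>+x. ennreal (G x powr t) \<partial>M)"
      using G0 by (simp add: h_def g_def powr_powr)
    finally show "(\<integral>\<^sup>+x. ennreal ((m x)\<^sup>2) \<partial>M) \<le> ennreal A * (\<integral>\<^sup>+x. ennreal (G x powr t) \<partial>M)" .
  qed
  also have "\<dots> = ennreal (4 powr (1 + \<kappa>) + A) * (\<integral>\<^sup>+x. ennreal (G x powr t) \<partial>M)"
    using A(2) by (simp add: distrib_right)
  finally show ?thesis using F0 G0 by (simp add: F G \<kappa>_def)
qed


section \<open>Dyadic grids\<close>

lemma measure_half_open_interval: "measure lebesgue {a..<a + c::real} = c" if "0 \<le> c"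
  using that by (subst measure_completion) auto

lemma dyadic_gridE:
  assumes "dyadic_grid G"
  obtains D :: "int \<Rightarrow> real set set" where "G = (\<Union>k. D k)" "\<And>k. \<Union>(D k) = UNIV"
    "\<And>k A B. A \<in> D k \<Longrightarrow> B \<in> D k \<Longrightarrow> A = B \<or> A \<inter> B = {}"
    "\<And>k I. I \<in> D k \<Longrightarrow> \<exists>a. I = {a..<a + 2 powi (- k)}"
    "\<And>k I. I \<in> D k \<Longrightarrow> \<exists>J\<in>D (k + 1). \<exists>J'\<in>D (k + 1). I = J \<union> J'"
proof -
  obtain D :: "int \<Rightarrow> real set set" where D: "G = (\<Union>k. D k) \<and>
        (\<forall>k. partition_on UNIV (D k)) \<and>
        (\<forall>k. \<forall>I\<in>D k. \<exists>a. I = {a..<a + 2 powi (- k)}) \<and>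
        (\<forall>k. \<forall>I\<in>D k. \<exists>J\<in>D (k + 1). \<exists>J'\<in>D (k + 1). J \<noteq> J' \<and> I = J \<union> J')"
    using assms unfolding dyadic_grid_def by (elim exE)
  note parts = conjunct1[OF D] conjunct1[OF conjunct2[OF D]]
    conjunct1[OF conjunct2[OF conjunct2[OF D]]] conjunct2[OF conjunct2[OF conjunct2[OF D]]]
  show thesis
  proof (rule that[of D])
    fix k A B I
    show "G = (\<Union>k. D k)" by (rule parts(1))
    show "\<Union>(D k) = UNIV" using parts(2) by (simp add: partition_on_def)
    show "A = B \<or> A \<inter> B = {}" if "A \<in> D k" "B \<in> D k"
      using parts(2) that by (auto simp: partition_on_def disjoint_def)
    show "\<exists>a. I = {a..<a + 2 powi (- k)}" if "I \<in> D k" using parts(3)[rule_format, OF that] .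
    show "\<exists>J\<in>D (k + 1). \<exists>J'\<in>D (k + 1). I = J \<union> J'" if "I \<in> D k"
    proof -
      from parts(4)[rule_format, OF that] obtain J J' where "J \<in> D (k + 1)" "J' \<in> D (k + 1)" "I = J \<union> J'"
        by (elim bexE conjE)
      then show ?thesis by (intro bexI[of _ J] bexI[of _ J'])
    qed
  qed
qed

lemma dyadic_grid_obtain_interval:
  assumes "dyadic_grid G" "I \<in> G"
  obtains a b where "a < b" "I = {a..<b}"
proof -
  obtain D where D: "G = (\<Union>k. D k)" "\<And>k. \<Union>(D k) = UNIV"
    "\<And>k A B. A \<in> D k \<Longrightarrow> B \<in> D k \<Longrightarrow> A = B \<or> A \<inter> B = {}"
    "\<And>k I. I \<in> D k \<Longrightarrow> \<exists>a. I = {a..<a + 2 powi (- k)}"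
    "\<And>k I. I \<in> D k \<Longrightarrow> \<exists>J\<in>D (k + 1). \<exists>J'\<in>D (k + 1). I = J \<union> J'"
    by (rule dyadic_gridE[OF assms(1)]) (rule that)
  then obtain k where "I \<in> D k" using assms(2) by auto
  from D(4)[OF this] obtain a where "I = {a..<a + 2 powi (- k)}" by (elim exE)
  moreover have "a < a + 2 powi (- k)" by simp
  ultimately show thesis by (intro that)
qed

text \<open>Every interval lies in one of the preceding level, namely the one that contains one of its points,
  because that one splits into intervals of its own level; iterate up to the level of the longer interval.\<close>

lemma dyadic_grid_nested:
  assumes G: "dyadic_grid G" and IJ: "I \<in> G" "J \<in> G" "measure lebesgue J \<le> measure lebesgue I"
  shows "J \<subseteq> I \<or> I \<inter> J = {}"
proof -
  obtain D where D: "G = (\<Union>k. D k)" "\<And>k. \<Union>(D k) = UNIV"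
    "\<And>k A B. A \<in> D k \<Longrightarrow> B \<in> D k \<Longrightarrow> A = B \<or> A \<inter> B = {}"
    "\<And>k I. I \<in> D k \<Longrightarrow> \<exists>a. I = {a..<a + 2 powi (- k)}"
    "\<And>k I. I \<in> D k \<Longrightarrow> \<exists>J\<in>D (k + 1). \<exists>J'\<in>D (k + 1). I = J \<union> J'"
    by (rule dyadic_gridE[OF G]) (rule that)
  have parent: "\<exists>A\<in>D k. J \<subseteq> A" if J: "J \<in> D (k + 1)" for J k
  proof -
    obtain x where x: "x \<in> J"
    proof -
      obtain a where "J = {a..<a + 2 powi (- (k + 1))}" using D(4)[OF J] by (elim exE)
      moreover have "0 < (2::real) powi (- (k + 1))" by simp
      ultimately show thesis by (intro that[of a]) simp
    qed
    have "x \<in> \<Union>(D k)" using D(2) by simp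
    then obtain A where A: "A \<in> D k" "x \<in> A" by (elim UnionE)
    from D(5)[OF A(1)] obtain J1 J2 where J12: "J1 \<in> D (k + 1)" "J2 \<in> D (k + 1)" "A = J1 \<union> J2"
      by (elim bexE)
    then have "J = J1 \<or> J = J2" using D(3)[OF J] x A(2) by blast
    then show ?thesis using A(1) J12 by blast
  qed
  have ancestor: "\<exists>A\<in>D k. J \<subseteq> A" if "J \<in> D (k + int n)" for J k n
    using that
  proof (induction n arbitrary: J)
    case (Suc n)
    then have "J \<in> D ((k + int n) + 1)" by (simp add: ac_simps)
    from parent[OF this] Suc.IH show ?case by (meson order_trans)
  qed auto
  have len: "measure lebesgue I = 2 powi (- k)" if I: "I \<in> D k" for I k
  proof -
    obtain a where "I = {a..<a + 2 powi (- k)}" using D(4)[OF I] by (elim exE)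
    then show ?thesis by (simp only: measure_half_open_interval zero_le_power_int zero_le_numeral)
  qed
  obtain k l where kl: "I \<in> D k" "J \<in> D l" using IJ D(1) by blast
  have "k \<le> l"
  proof (rule ccontr)
    assume "\<not> k \<le> l"
    then have "(2::real) powi (- k) < 2 powi (- l)" by (intro power_int_strict_increasing) auto
    then show False using IJ(3) len kl by simp
  qed
  then have "l = k + int (nat (l - k))" by simp
  then obtain A where "A \<in> D k" "J \<subseteq> A" using ancestor kl(2) by metis
  then show ?thesis using D(3)[OF kl(1)] by blast
qed

lemma countable_dyadic_grid:
  assumes "dyadic_grid G"
  shows "countable G"
proof -
  obtain D where D: "G = (\<Union>k. D k)" "\<And>k. \<Union>(D k) = UNIV"
    "\<And>k A B. A \<in> D k \<Longrightarrow> B \<in> D k \<Longrightarrow> A = B \<or> A \<inter> B = {}"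
    "\<And>k I. I \<in> D k \<Longrightarrow> \<exists>a. I = {a..<a + 2 powi (- k)}"
    "\<And>k I. I \<in> D k \<Longrightarrow> \<exists>J\<in>D (k + 1). \<exists>J'\<in>D (k + 1). I = J \<union> J'"
    by (rule dyadic_gridE[OF assms]) (rule that)
  have "countable (D k)" for k
  proof (rule countable_disjoint_nonempty_interior_subsets)
    show "pairwise disjnt (D k)"
      using D(3) unfolding pairwise_def disjnt_def by blast
    fix I assume I: "I \<in> D k" and int: "interior I = {}"
    obtain a where a: "I = {a..<a + 2 powi (- k)}" using D(4)[OF I] by (elim exE)
    have "(0::real) < 2 powi (- k)" by simp
    moreover have "interior I = {a<..<a + 2 powi (- k)}" unfolding a by (rule interior_atLeastLessThan)
    ultimately have "a + 2 powi (- k) / 2 \<in> interior I" by simp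
    then show "I = {}" unfolding int by (rule emptyE)
  qed
  then show ?thesis using D(1) by simp
qed

lemma cube_grid_cube:
  fixes G :: "'n::finite \<Rightarrow> real set set"
  assumes G: "\<And>i. dyadic_grid (G i)" and Q: "Q \<in> cube_grid G"
  shows "Q \<in> sets borel" "0 < emeasure lborel Q" "emeasure lborel Q < \<infinity>"
proof -
  obtain I where I: "Q = {x. \<forall>i. x $ i \<in> I i}" "\<And>i. I i \<in> G i"
    using Q unfolding cube_grid_def by blast
  have "\<exists>a b. a < b \<and> I i = {a..<b}" for i
    using dyadic_grid_obtain_interval[OF G I(2), of i] by blast
  then obtain a b where ab: "\<And>i. a i < b i" "\<And>i. I i = {a i..<b i}" by metis
  show "Q \<in> sets borel"
  proof -
    have "Q = (\<Inter>i. {x. x $ i \<in> I i})" by (auto simp: I(1))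
    moreover have "{x::real^'n. x $ i \<in> I i} \<in> sets borel" for i
    proof -
      have "(\<lambda>x::real^'n. x $ i) \<in> borel_measurable borel"
        by (intro borel_measurable_continuous_onI continuous_intros)
      then have "(\<lambda>x::real^'n. x $ i) -` {a i..<b i} \<inter> space borel \<in> sets borel"
        by (rule measurable_sets) simp
      then show ?thesis by (simp add: ab(2) vimage_def)
    qed
    ultimately show ?thesis by (simp add: sets.countable_INT'')
  qed
  have sub: "box (\<chi> i. a i) (\<chi> i. b i) \<subseteq> Q" "Q \<subseteq> cbox (\<chi> i. a i) (\<chi> i. b i)"
    by (auto simp: I(1) ab(2) mem_box_cart less_imp_le)
  have "0 < (\<Prod>e\<in>Basis. ((\<chi> i. b i) - (\<chi> i. a i) :: real^'n) \<bullet> e)"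
    using ab(1) by (intro prod_pos) (auto simp: Basis_vec_def inner_axis)
  moreover have "\<forall>e\<in>Basis. (\<chi> i. a i :: real^'n) \<bullet> e \<le> (\<chi> i. b i) \<bullet> e"
    using ab(1) by (auto simp: Basis_vec_def inner_axis less_imp_le)
  ultimately have "0 < emeasure lborel (box (\<chi> i. a i) (\<chi> i. b i))"
    by (simp add: emeasure_lborel_box_eq)
  also have "\<dots> \<le> emeasure lborel Q" using sub(1) \<open>Q \<in> sets borel\<close> by (intro emeasure_mono) auto
  finally show "0 < emeasure lborel Q" .
  have "emeasure lborel Q \<le> emeasure lborel (cbox (\<chi> i. a i) (\<chi> i. b i))"
    using sub(2) by (intro emeasure_mono) auto
  also have "\<dots> < \<infinity>" by (rule emeasure_lborel_cbox_finite)
  finally show "emeasure lborel Q < \<infinity>" .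
qed

text \<open>All edges of a cube have the same length, so of two cubes the same one has the shorter edge in every
  coordinate, and the one-dimensional statement applies in the same direction throughout.\<close>

lemma cube_grid_nested:
  fixes G :: "'n::finite \<Rightarrow> real set set"
  assumes G: "\<And>i. dyadic_grid (G i)"
  shows "nested (cube_grid G)"
  unfolding nested_def
proof (intro ballI)
  fix Q Q' assume "Q \<in> cube_grid G" "Q' \<in> cube_grid G"
  then obtain I I' where Q: "Q = {x. \<forall>i. x $ i \<in> I i}" "Q' = {x. \<forall>i. x $ i \<in> I' i}"
    and I: "\<And>i. I i \<in> G i" "\<And>i. I' i \<in> G i"
    and len: "\<And>i j. measure lebesgue (I i) = measure lebesgue (I j)"
      "\<And>i j. measure lebesgue (I' i) = measure lebesgue (I' j)"
    unfolding cube_grid_def by blast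
  obtain j :: 'n where True by blast
  have sub: "{x. \<forall>i. x $ i \<in> B i} \<subseteq> {x::real^'n. \<forall>i. x $ i \<in> A i} \<or>
      {x::real^'n. \<forall>i. x $ i \<in> A i} \<inter> {x. \<forall>i. x $ i \<in> B i} = {}"
    if A: "\<And>i. A i \<in> G i" and B: "\<And>i. B i \<in> G i"
      and le: "\<And>i. measure lebesgue (B i) \<le> measure lebesgue (A i)" for A B
  proof (cases "\<forall>i. B i \<subseteq> A i")
    case False
    then obtain i where "A i \<inter> B i = {}" using dyadic_grid_nested[OF G A B le] by blast
    then show ?thesis by blast
  qed blast
  consider "measure lebesgue (I' j) \<le> measure lebesgue (I j)" | "measure lebesgue (I j) \<le> measure lebesgue (I' j)"
    by linarith
  then show "Q \<subseteq> Q' \<or> Q' \<subseteq> Q \<or> Q \<inter> Q' = {}"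
  proof cases
    case 1
    then have "measure lebesgue (I' i) \<le> measure lebesgue (I i)" for i using len by metis
    from sub[OF I this] show ?thesis unfolding Q by blast
  next
    case 2
    then have "measure lebesgue (I i) \<le> measure lebesgue (I' i)" for i using len by metis
    from sub[OF I(2,1) this] show ?thesis unfolding Q by blast
  qed
qed

lemma countable_cube_grid:
  fixes G :: "'n::finite \<Rightarrow> real set set"
  assumes G: "\<And>i. dyadic_grid (G i)"
  shows "countable (cube_grid G)"
proof -
  have "cube_grid G \<subseteq> (\<lambda>I. {x. \<forall>i. x $ i \<in> I i}) ` (\<Pi>\<^sub>E i\<in>UNIV. G i)"
    unfolding cube_grid_def by (auto simp: PiE_UNIV_domain)
  moreover have "countable (\<Pi>\<^sub>E i\<in>UNIV. G i)"
    using countable_dyadic_grid[OF G] by (intro countable_PiE) auto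
  ultimately show ?thesis by (meson countable_image countable_subset)
qed

lemma
  assumes "dyadic_cube_grid \<D>"
  shows countable_dyadic_cube_grid: "countable \<D>" and nested_dyadic_cube_grid: "nested \<D>"
    and averaging_family_dyadic_cube_grid: "\<And>\<F>. finite \<F> \<Longrightarrow> \<F> \<subseteq> \<D> \<Longrightarrow> averaging_family lborel \<F>"
proof -
  obtain G where G: "\<And>i. dyadic_grid (G i)" "\<D> = cube_grid G"
    using assms unfolding dyadic_cube_grid_def by blast
  show "countable \<D>" "nested \<D>"
    using countable_cube_grid[OF G(1)] cube_grid_nested[OF G(1)] by (simp_all add: G(2))
  show "averaging_family lborel \<F>" if "finite \<F>" "\<F> \<subseteq> \<D>" for \<F>
    using that cube_grid_cube[of G, OF G(1)] unfolding averaging_family_def G(2) by auto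
qed

lemma nested_subset: "nested \<D> \<Longrightarrow> \<F> \<subseteq> \<D> \<Longrightarrow> nested \<F>"
  unfolding nested_def by blast

lemma countable_product_grid:
  assumes "dyadic_cube_grid \<D>1" "dyadic_cube_grid \<D>2"
  shows "countable (product_grid \<D>1 \<D>2)"
proof -
  have "product_grid \<D>1 \<D>2 = (\<lambda>(R1, R2). R1 \<times> R2) ` (\<D>1 \<times> \<D>2)"
    unfolding product_grid_def by auto
  moreover have "countable (\<D>1 \<times> \<D>2)"
    using countable_dyadic_cube_grid[OF assms(1)] countable_dyadic_cube_grid[OF assms(2)] by simp
  ultimately show ?thesis by simp
qed

lemma finite_subset_product_grid:
  assumes "finite \<F>" "\<F> \<subseteq> product_grid \<D>1 \<D>2"
  obtains \<F>1 \<F>2 where "finite \<F>1" "\<F>1 \<subseteq> \<D>1" "finite \<F>2" "\<F>2 \<subseteq> \<D>2" "\<F> \<subseteq> rectangles \<F>1 \<F>2"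
proof -
  have "\<forall>R\<in>\<F>. \<exists>P. fst P \<in> \<D>1 \<and> snd P \<in> \<D>2 \<and> R = fst P \<times> snd P"
    using assms(2) unfolding product_grid_def by fastforce
  from bchoice[OF this] obtain s where s: "\<And>R. R \<in> \<F> \<Longrightarrow> fst (s R) \<in> \<D>1 \<and> snd (s R) \<in> \<D>2 \<and> R = fst (s R) \<times> snd (s R)"
    by blast
  show thesis
  proof (rule that[of "(fst \<circ> s) ` \<F>" "(snd \<circ> s) ` \<F>"])
    show "\<F> \<subseteq> rectangles ((fst \<circ> s) ` \<F>) ((snd \<circ> s) ` \<F>)"
    proof
      fix R assume R: "R \<in> \<F>"
      then have "R = (\<lambda>(Q1, Q2). Q1 \<times> Q2) (fst (s R), snd (s R))" using s[OF R] by (simp only: prod.case)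
      then show "R \<in> rectangles ((fst \<circ> s) ` \<F>) ((snd \<circ> s) ` \<F>)"
        unfolding rectangles_def
      proof (rule image_eqI)
        show "(fst (s R), snd (s R)) \<in> (fst \<circ> s) ` \<F> \<times> (snd \<circ> s) ` \<F>"
          using imageI[OF R, of "fst \<circ> s"] imageI[OF R, of "snd \<circ> s"] by (simp only: mem_Times_iff fst_conv snd_conv comp_apply)
      qed
    qed
  qed (use s assms(1) in auto)
qed

lemma sigma_finite_lborel: "sigma_finite_measure lborel" ..

lemma averaging_family_product_grid:
  fixes \<D>1 :: "(real^'n::finite) set set" and \<D>2 :: "(real^'m::finite) set set"
  assumes "dyadic_cube_grid \<D>1" "dyadic_cube_grid \<D>2" and "finite \<F>" "\<F> \<subseteq> product_grid \<D>1 \<D>2"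
  shows "averaging_family lborel \<F>"
proof -
  obtain \<F>1 \<F>2 where \<F>: "finite \<F>1" "\<F>1 \<subseteq> \<D>1" "finite \<F>2" "\<F>2 \<subseteq> \<D>2" "\<F> \<subseteq> rectangles \<F>1 \<F>2"
    using finite_subset_product_grid[OF assms(3,4)] by blast
  have "averaging_family (lborel \<Otimes>\<^sub>M lborel) (rectangles \<F>1 \<F>2)"
    by (intro averaging_family_rectangles sigma_finite_lborel averaging_family_dyadic_cube_grid[OF assms(1)]
        averaging_family_dyadic_cube_grid[OF assms(2)] \<F>)
  then show ?thesis using \<F>(5) assms(3) unfolding lborel_prod averaging_family_def by blast
qed

lemma maximal_bound_product_grid:
  fixes \<D>1 :: "(real^'n::finite) set set" and \<D>2 :: "(real^'m::finite) set set"
  assumes \<D>: "dyadic_cube_grid \<D>1" "dyadic_cube_grid \<D>2" and \<F>': "finite \<F>" "\<F> \<subseteq> product_grid \<D>1 \<D>2"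
    and q: "1 < q"
  shows "maximal_bound lborel \<F> q ((maximal_const q)\<^sup>2)"
  unfolding maximal_bound_def
proof (intro allI impI)
  fix g :: "(real^'n) \<times> (real^'m) \<Rightarrow> ennreal" and B
  assume g: "g \<in> borel_measurable lborel" "\<forall>x. g x \<le> ennreal B"
  obtain \<F>1 \<F>2 where \<F>: "finite \<F>1" "\<F>1 \<subseteq> \<D>1" "finite \<F>2" "\<F>2 \<subseteq> \<D>2" "\<F> \<subseteq> rectangles \<F>1 \<F>2"
    using finite_subset_product_grid[OF \<F>'] by blast
  have "(\<integral>\<^sup>+x. ennreal_powr (maximal_function lborel \<F> g x) q \<partial>lborel)
      \<le> (\<integral>\<^sup>+x. ennreal_powr (maximal_function lborel (rectangles \<F>1 \<F>2) g x) q \<partial>lborel)"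
    unfolding maximal_function_def using \<F>(5) q
    by (intro nn_integral_mono ennreal_powr_mono SUP_subset_mono) auto
  also have "\<dots> \<le> ennreal ((maximal_const q)\<^sup>2) * (\<integral>\<^sup>+x. ennreal_powr (g x) q \<partial>lborel)"
    unfolding lborel_prod[symmetric]
    using q g(1) g(2)[rule_format]
    by (intro maximal_function_rectangles_strong_type[where B = B] sigma_finite_lborel \<F>
        averaging_family_dyadic_cube_grid[OF \<D>(1)] averaging_family_dyadic_cube_grid[OF \<D>(2)]
        nested_subset[OF nested_dyadic_cube_grid[OF \<D>(1)]] nested_subset[OF nested_dyadic_cube_grid[OF \<D>(2)]])
      (simp_all add: lborel_prod)
  finally show "(\<integral>\<^sup>+x. ennreal_powr (maximal_function lborel \<F> g x) q \<partial>lborel)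
      \<le> ennreal ((maximal_const q)\<^sup>2) * (\<integral>\<^sup>+x. ennreal_powr (g x) q \<partial>lborel)" .
qed

definition shrink_const :: "real \<Rightarrow> real" where
  "shrink_const t = (if t \<le> 1 then 4 powr (1 + 2 * (1 - t) / t) + (maximal_const 2)\<^sup>2
     else 4 * (4 * (maximal_const (t / (t - 1)))\<^sup>2) powr (t - 1))"

text \<open>The exponents \<open>2\<close> and \<open>t / (t - 1)\<close> of the maximal bounds both exceed one. Indices with weight zero are
  dropped because the case \<open>t \<le> 1\<close> involves negative powers of the sums.\<close>

lemma shrink_rectangles:
  fixes \<D>1 :: "(real^'n::finite) set set" and \<D>2 :: "(real^'m::finite) set set"
  assumes t: "0 < t" and \<D>: "dyadic_cube_grid \<D>1" "dyadic_cube_grid \<D>2"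
    and I: "finite I" "R ` I \<subseteq> product_grid \<D>1 \<D>2" and b: "\<And>i. i \<in> I \<Longrightarrow> 0 \<le> b i"
    and E: "\<And>i. i \<in> I \<Longrightarrow> E i \<in> sets borel" "\<And>i. i \<in> I \<Longrightarrow> E i \<subseteq> R i"
      "\<And>i. i \<in> I \<Longrightarrow> emeasure lborel (R i) \<le> 2 * emeasure lborel (E i)"
  shows "(\<integral>\<^sup>+x. ennreal_powr (weighted_count b R I x) t \<partial>lborel)
    \<le> ennreal (shrink_const t) * (\<integral>\<^sup>+x. ennreal_powr (weighted_count b E I x) t \<partial>lborel)"
proof -
  define J where "J = {i\<in>I. 0 < b i}"
  have J: "finite J" "R ` J \<subseteq> product_grid \<D>1 \<D>2" using I by (auto simp: J_def)
  have count: "weighted_count b S I x = weighted_count b S J x" for S :: "_ \<Rightarrow> ((real^'n) \<times> (real^'m)) set" and x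
    unfolding weighted_count_def using I(1)
  proof (rule sum.mono_neutral_right)
    show "\<forall>i\<in>I - J. ennreal (b i) * indicator (S i) x = 0"
      using b by (force simp: J_def)
  qed (auto simp: J_def)
  note fam = averaging_family_product_grid[OF \<D> finite_imageI[OF J(1)] J(2)]
  note max = maximal_bound_product_grid[OF \<D> finite_imageI[OF J(1)] J(2)]
  show ?thesis
  proof (cases "t \<le> 1")
    case True
    have "(\<integral>\<^sup>+x. ennreal_powr (weighted_count b R J x) t \<partial>lborel)
      \<le> ennreal (4 powr (1 + 2 * (1 - t) / t) + (maximal_const 2)\<^sup>2)
        * (\<integral>\<^sup>+x. ennreal_powr (weighted_count b E J x) t \<partial>lborel)"
      using t True J(1) fam max[of 2] E by (intro shrink_sets_exponent_le_one) (auto simp: J_def)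
    then show ?thesis using True by (simp add: count shrink_const_def)
  next
    case False
    then have q: "1 < t / (t - 1)" by simp
    then have "0 < maximal_const (t / (t - 1))" using False by (simp add: maximal_const_def)
    then have "(\<integral>\<^sup>+x. ennreal_powr (weighted_count b R J x) t \<partial>lborel)
      \<le> ennreal (4 * (4 * (maximal_const (t / (t - 1)))\<^sup>2) powr (t - 1))
        * (\<integral>\<^sup>+x. ennreal_powr (weighted_count b E J x) t \<partial>lborel)"
      using False J(1) fam max[OF q] E by (intro shrink_sets_exponent_gt_one) (auto simp: J_def)
    then show ?thesis using False by (simp add: count shrink_const_def)
  qed
qed


section \<open>Reducing operators on large subsets\<close>

lemma norm_matrix_vector_le: "norm (A *v x) \<le> matrix_norm A * norm x"
  for A :: "complex^'d^'d::finite"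
  unfolding matrix_norm_def by (rule onorm) simp

lemma norm_matrix_powr_quotient:
  fixes B :: "complex^'d^'d::finite"
  assumes "positive_definite A"
  shows "norm (B *v e) \<le> matrix_norm (B ** matrix_powr A (- s)) * norm (matrix_powr A s *v e)"
proof -
  have "B *v e = (B ** matrix_powr A (- s)) *v (matrix_powr A s *v e)"
    by (simp add: matrix_vector_mul_assoc matrix_mul_assoc[symmetric] matrix_powr_minus_mult[OF assms])
  then show ?thesis using norm_matrix_vector_le by metis
qed

lemma positive_definite_injective: "positive_definite A \<Longrightarrow> e \<noteq> 0 \<Longrightarrow> A *v e \<noteq> 0"
  unfolding positive_definite_def by force

lemma matrix_powr_injective:
  assumes "positive_definite A" "e \<noteq> 0"
  shows "matrix_powr A s *v e \<noteq> 0"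
proof
  assume "matrix_powr A s *v e = 0"
  then have "mat 1 *v e = 0"
    by (metis matrix_powr_minus_mult[OF assms(1), of s] matrix_vector_mul_assoc matrix_vector_mult_0_right)
  then show False using assms(2) by simp
qed

lemma average_mono_AE:
  "AE x in lebesgue. g x \<le> h x \<Longrightarrow> average E g \<le> average E h"
  unfolding average_def
  by (intro divide_right_mono_ennreal nn_integral_mono_AE) (auto elim!: eventually_mono simp: indicator_def)

lemma average_cmult:
  assumes "g \<in> borel_measurable lebesgue" "E \<in> sets lebesgue"
  shows "average E (\<lambda>x. c * g x) = c * average E g"
  unfolding average_def using assms
  by (simp add: nn_integral_cmult mult.assoc ennreal_times_divide)

text \<open>Integrating \<open>v(x)\<^bsup>r\<^esup> v(y)\<^bsup>-r\<^esup> \<le> |W(x)\<^bsup>1/p\<^esup> W(y)\<^bsup>-1/p\<^esup>|\<^bsup>r\<^esup>\<close> first in \<open>y\<close>, with \<open>r\<close> the conjugate exponent, and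
  then, after raising to the power \<open>p / r\<close>, in \<open>x\<close> turns the \<open>A\<^sub>p\<close> average into a product of the \<open>p\<close>-th moment of
  \<open>v\<close> and a power of its moment of order \<open>-r\<close>. The reducing operator compares with the former.\<close>

lemma reducing_operator_negative_moment:
  fixes W :: "'a::euclidean_space \<Rightarrow> complex^'d^'d::finite"
  assumes p: "1 < p" and W: "W \<in> borel_measurable lebesgue" "AE x in lebesgue. positive_definite (W x)"
    and R: "R \<in> sets lebesgue" and A: "reducing_operator p W R A"
  shows "ennreal (norm (A *v e) powr p)
      * ennreal_powr (average R (\<lambda>y. ennreal (norm (matrix_powr (W y) (1 / p) *v e) powr - conj_exponent p)))
          (p / conj_exponent p)
    \<le> ennreal (real CARD('d) powr (p / 2)) * average R (\<lambda>x. ennreal_powr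
          (average R (\<lambda>y. ennreal (matrix_norm (matrix_powr (W x) (1 / p) ** matrix_powr (W y) (- 1 / p))
               powr conj_exponent p))) (p / conj_exponent p))"
proof -
  define r where "r = conj_exponent p"
  have r: "0 < r" using p by (simp add: r_def conj_exponent_def)
  define v where "v = (\<lambda>x. norm (matrix_powr (W x) (1 / p) *v e))"
  have v [measurable]: "v \<in> borel_measurable lebesgue"
    unfolding v_def by (rule measurable_matrix_powr_norm[OF W])
  define J where "J = average R (\<lambda>y. ennreal (v y powr - r))"
  define K where "K = (\<lambda>x y. matrix_norm (matrix_powr (W x) (1 / p) ** matrix_powr (W y) (- 1 / p)))"
  define S where "S = (\<lambda>x. ennreal_powr (average R (\<lambda>y. ennreal (K x y powr r))) (p / r))"
  have "ennreal_powr J (p / r) * ennreal (v x powr p) \<le> S x" for x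
  proof -
    have "AE y in lebesgue. ennreal (v x powr r) * ennreal (v y powr - r) \<le> ennreal (K x y powr r)"
      using W(2)
    proof eventually_elim
      case (elim y)
      have le: "v x \<le> K x y * v y"
        using norm_matrix_powr_quotient[OF elim, of "matrix_powr (W x) (1 / p)" e "1 / p"]
        by (simp add: v_def K_def)
      have K0: "0 \<le> K x y" by (simp add: K_def matrix_norm_def onorm_pos_le)
      have "v x powr r * v y powr - r \<le> K x y powr r"
      proof (cases "v y = 0")
        case False
        then have vy: "0 < v y" by (simp add: v_def)
        have "v x powr r \<le> (K x y * v y) powr r"
          using le r by (intro powr_mono2) (auto simp: v_def)
        also have "\<dots> = K x y powr r * v y powr r" using K0 vy by (simp add: powr_mult)
        finally show ?thesis using vy by (simp add: powr_minus field_simps)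
      qed simp
      then show ?case by (simp add: ennreal_mult[symmetric] ennreal_leI)
    qed
    then have "ennreal (v x powr r) * J \<le> average R (\<lambda>y. ennreal (K x y powr r))"
      unfolding J_def using R by (subst average_cmult[symmetric]) (auto intro: average_mono_AE)
    then have "ennreal_powr (ennreal (v x powr r) * J) (p / r) \<le> S x"
      unfolding S_def using p r by (intro ennreal_powr_mono) auto
    then show ?thesis
      using p r by (simp add: ennreal_powr_mult powr_powr mult.commute)
  qed
  then have "average R (\<lambda>x. ennreal_powr J (p / r) * ennreal (v x powr p)) \<le> average R S"
    by (intro average_mono_AE) simp
  then have moment: "ennreal_powr J (p / r) * average R (\<lambda>x. ennreal (v x powr p)) \<le> average R S"
    using R by (subst (asm) average_cmult) auto
  have "ennreal (norm (A *v e)) \<le> ennreal (sqrt (real CARD('d))) * ennreal_powr (average R (\<lambda>x. ennreal (v x powr p))) (1 / p)"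
    using A unfolding reducing_operator_def Let_def v_def by blast
  then have "ennreal_powr (ennreal (norm (A *v e))) p
      \<le> ennreal_powr (ennreal (sqrt (real CARD('d))) * ennreal_powr (average R (\<lambda>x. ennreal (v x powr p))) (1 / p)) p"
    using p by (intro ennreal_powr_mono) auto
  also have "\<dots> = ennreal (real CARD('d) powr (p / 2)) * average R (\<lambda>x. ennreal (v x powr p))"
    using p by (simp add: ennreal_powr_mult ennreal_powr_powr powr_half_sqrt[symmetric] powr_powr)
  finally have "ennreal (norm (A *v e) powr p) * ennreal_powr J (p / r)
      \<le> (ennreal (real CARD('d) powr (p / 2)) * average R (\<lambda>x. ennreal (v x powr p))) * ennreal_powr J (p / r)"
    by (intro mult_right_mono) auto
  also have "\<dots> \<le> ennreal (real CARD('d) powr (p / 2)) * average R S"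
    using moment by (simp add: mult.assoc mult.commute[of "average R _"] mult_left_mono)
  finally show ?thesis by (simp add: J_def S_def K_def v_def r_def)
qed

lemma negative_moment_positive:
  assumes R: "R \<in> sets lebesgue" "0 < emeasure lebesgue R" "emeasure lebesgue R < \<infinity>"
    and v [measurable]: "v \<in> borel_measurable lebesgue" and pos: "AE x in lebesgue. 0 < (v x :: real)"
  shows "0 < average R (\<lambda>y. ennreal (v y powr - s))"
proof (rule ccontr)
  assume "\<not> ?thesis"
  then have "(\<integral>\<^sup>+y\<in>R. ennreal (v y powr - s) \<partial>lebesgue) = 0"
    using R by (auto simp: average_def)
  then have "AE y in lebesgue. ennreal (v y powr - s) * indicator R y = 0"
    using R(1) by (subst (asm) nn_integral_0_iff_AE) auto
  with pos have "AE y in lebesgue. y \<notin> R"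
    by eventually_elim (auto simp: indicator_def split: if_splits)
  then have "emeasure lebesgue R = 0"
    using R(1) by (simp add: AE_iff_measurable[OF R(1)] emeasure_eq_AE[of _ "{}"] emeasure_0_AE)
  then show False using R by simp
qed

text \<open>Markov's inequality bounds the measure of \<open>{v < c}\<close> by half that of \<open>R\<close>. The complement is only Lebesgue
  measurable; its main part is a Borel subset of the same measure.\<close>

lemma large_set_of_negative_moment:
  fixes v :: "'a::euclidean_space \<Rightarrow> real"
  assumes R: "R \<in> sets borel" "emeasure lborel R < \<infinity>"
    and v [measurable]: "v \<in> borel_measurable lebesgue" and pos: "AE x in lebesgue. 0 < v x"
    and s: "0 < s" and c: "0 < c"
    and moment: "average R (\<lambda>y. ennreal (v y powr - s)) \<le> ennreal (c powr - s / 2)"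
  shows "\<exists>E\<in>sets borel. E \<subseteq> R \<and> emeasure lborel R \<le> 2 * emeasure lborel E \<and> (\<forall>y\<in>E. c \<le> v y)"
proof -
  have RL [measurable]: "R \<in> sets lebesgue" using R(1) by simp
  have mR: "emeasure lebesgue R = emeasure lborel R" using R(1) by simp
  define B where "B = {y\<in>R. v y < c}"
  have BL: "B \<in> sets lebesgue"
  proof -
    have "B = R \<inter> {y\<in>space lebesgue. v y < c}" by (auto simp: B_def)
    also have "\<dots> \<in> sets lebesgue" by measurable
    finally show ?thesis .
  qed
  define G where "G = R - B"
  have GL: "G \<in> sets lebesgue" unfolding G_def using RL BL by blast
  obtain m where m: "0 \<le> m" "emeasure lebesgue R = ennreal m"
    using R(2) mR by (cases "emeasure lborel R") auto
  have "ennreal (c powr - s) * emeasure lebesgue B = (\<integral>\<^sup>+y. ennreal (c powr - s) * indicator B y \<partial>lebesgue)"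
    using BL by (simp add: nn_integral_cmult_indicator)
  also have "\<dots> \<le> (\<integral>\<^sup>+y\<in>R. ennreal (v y powr - s) \<partial>lebesgue)"
  proof (rule nn_integral_mono_AE)
    show "AE y in lebesgue. ennreal (c powr - s) * indicator B y \<le> ennreal (v y powr - s) * indicator R y"
      using pos
    proof eventually_elim
      case (elim y)
      have "c powr - s \<le> v y powr - s" if "y \<in> B"
        using that elim s by (intro powr_mono2') (auto simp: B_def)
      then show ?case by (cases "y \<in> B") (auto simp: B_def intro!: ennreal_leI)
    qed
  qed
  also have "\<dots> \<le> ennreal (c powr - s / 2) * ennreal m"
  proof (cases "m = 0")
    case True
    then have "R \<in> null_sets lebesgue" using m RL by auto
    then have "(\<integral>\<^sup>+y\<in>R. ennreal (v y powr - s) \<partial>lebesgue) = 0" by (rule nn_integral_null_set)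
    then show ?thesis by simp
  next
    case False
    then have "(\<integral>\<^sup>+y\<in>R. ennreal (v y powr - s) \<partial>lebesgue) = average R (\<lambda>y. ennreal (v y powr - s)) * ennreal m"
      using m by (simp add: average_def ennreal_divide_times divide_ennreal)
    then show ?thesis using moment by (simp add: mult_right_mono)
  qed
  finally have mark: "ennreal (c powr - s) * emeasure lebesgue B \<le> ennreal (c powr - s / 2) * ennreal m" .
  have "emeasure lebesgue B \<le> emeasure lebesgue R" using RL by (intro emeasure_mono) (auto simp: B_def)
  then obtain b where b: "0 \<le> b" "emeasure lebesgue B = ennreal b"
    using m by (cases "emeasure lebesgue B") (auto simp: top_unique)
  have "ennreal (c powr - s * b) \<le> ennreal (c powr - s / 2 * m)"
    using mark unfolding b(2) by (simp only: ennreal_mult'[symmetric] powr_ge_zero divide_nonneg_nonneg zero_le_numeral)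
  then have "c powr - s * b \<le> c powr - s * (m / 2)"
    using m by (subst (asm) ennreal_le_iff) auto
  then have bm: "b \<le> m / 2" using c by simp
  have "emeasure lebesgue G = ennreal (m - b)"
    unfolding G_def using b m RL BL
    by (subst emeasure_Diff) (auto simp: B_def ennreal_minus)
  define E where "E = main_part lborel G"
  have E: "E \<in> sets borel" using main_part_sets[OF GL] by (simp add: E_def)
  moreover have "E \<subseteq> G" unfolding E_def using main_part_null_part_Un[OF GL] by blast
  moreover have "emeasure lborel E = ennreal (m - b)"
    using \<open>emeasure lebesgue G = _\<close> emeasure_completion[OF GL] by (simp add: E_def)
  moreover have "ennreal m \<le> 2 * ennreal (m - b)"
    using bm m by (simp add: ennreal_mult'[symmetric] ennreal_leI flip: ennreal_numeral)
  ultimately show ?thesis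
    using m mR by (intro bexI[of _ E]) (auto simp: G_def B_def not_less)
qed

text \<open>The number \<open>c = |A e| / K\<close> is the level for which the negative moment bound reads \<open>c\<^bsup>-r\<^esup> / 2\<close>; this fixes the
  constant \<open>K\<close>. That \<open>[W] > 0\<close>, needed for \<open>K > 0\<close>, comes out of the same bound, its left side being
  positive.\<close>

lemma reducing_operator_le_on_large_set:
  fixes W :: "'a::euclidean_space \<Rightarrow> complex^'d^'d::finite"
  assumes p: "1 < p" and W: "Ap_weight p \<D> W" and R: "R \<in> \<D>" "R \<in> sets borel"
      "0 < emeasure lborel R" "emeasure lborel R < \<infinity>"
    and A: "reducing_operator p W R A"
  defines "K \<equiv> 2 powr (1 / conj_exponent p) * sqrt (real CARD('d)) * enn2real (Ap_constant p \<D> W) powr (1 / p)"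
  shows "\<exists>E\<in>sets borel. E \<subseteq> R \<and> emeasure lborel R \<le> 2 * emeasure lborel E \<and>
    (\<forall>y\<in>E. norm (A *v e) \<le> K * norm (matrix_powr (W y) (1 / p) *v e))"
proof (cases "e = 0")
  case True
  then show ?thesis using R by (intro bexI[of _ R]) (auto simp: mult_2)
next
  case False
  define r where "r = conj_exponent p"
  have r: "0 < r" using p by (simp add: r_def conj_exponent_def)
  have Wm: "W \<in> borel_measurable lebesgue" and pd: "AE x in lebesgue. positive_definite (W x)"
    using W locally_integrable_imp_measurable by (auto simp: Ap_weight_def matrix_weight_def)
  define v where "v = (\<lambda>y. norm (matrix_powr (W y) (1 / p) *v e))"
  have v [measurable]: "v \<in> borel_measurable lebesgue"
    unfolding v_def by (rule measurable_matrix_powr_norm[OF Wm pd])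
  have vpos: "AE x in lebesgue. 0 < v x"
    using pd by eventually_elim (use False matrix_powr_injective in \<open>auto simp: v_def\<close>)
  define a where "a = norm (A *v e)"
  have a: "0 < a"
    using A False positive_definite_injective by (auto simp: a_def reducing_operator_def)
  define w where "w = enn2real (Ap_constant p \<D> W)"
  have w: "Ap_constant p \<D> W = ennreal w" "0 \<le> w"
    using W by (auto simp: w_def Ap_weight_def)
  define d where "d = real CARD('d)"
  have d: "0 < d" by (simp add: d_def)
  define J where "J = average R (\<lambda>y. ennreal (v y powr - r))"
  have Jpos: "0 < J"
    unfolding J_def using R v vpos by (intro negative_moment_positive) auto
  have "ennreal (a powr p) * ennreal_powr J (p / r) \<le> ennreal (d powr (p / 2)) * average R (\<lambda>x. ennreal_powr
          (average R (\<lambda>y. ennreal (matrix_norm (matrix_powr (W x) (1 / p) ** matrix_powr (W y) (- 1 / p))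
               powr conj_exponent p))) (p / conj_exponent p))"
    unfolding a_def J_def d_def v_def r_def using R
    by (intro reducing_operator_negative_moment[OF p Wm pd _ A]) auto
  also have "\<dots> \<le> ennreal (d powr (p / 2)) * Ap_constant p \<D> W"
    unfolding Ap_constant_def using R(1) by (intro mult_left_mono SUP_upper) auto
  finally have main: "ennreal (a powr p) * ennreal_powr J (p / r) \<le> ennreal (d powr (p / 2) * w)"
    using w by (simp add: ennreal_mult)
  obtain j where j: "0 < j" "J = ennreal j"
    using main Jpos a p by (cases J) (auto simp: ennreal_mult_top top_unique)
  have main': "a powr p * j powr (p / r) \<le> d powr (p / 2) * w"
    using main j w d a by (simp add: ennreal_mult[symmetric])
  have "0 < a powr p * j powr (p / r)" using a j by simp
  then have wpos: "0 < w" using main' d w by (metis less_le_trans mult_zero_right not_less_iff_gr_or_eq le_less)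
  define c where "c = a / K"
  have K: "K = 2 powr (1 / r) * d powr (1 / 2) * w powr (1 / p)"
    by (simp add: K_def r_def d_def w_def powr_half_sqrt)
  have Kpos: "0 < K" using d wpos by (simp add: K)
  have cpos: "0 < c" using a Kpos by (simp add: c_def)
  have "(j powr (p / r)) powr (r / p) \<le> (d powr (p / 2) * w / a powr p) powr (r / p)"
    using main' a p r by (intro powr_mono2) (auto simp: field_simps)
  then have "j \<le> (d powr (p / 2) * w / a powr p) powr (r / p)"
    using j p r by (simp add: powr_powr)
  also have "\<dots> = d powr (r / 2) * w powr (r / p) / a powr r"
    using d wpos a p by (simp add: powr_mult powr_divide powr_powr)
  also have "\<dots> = c powr - r / 2"
    using d wpos a Kpos r unfolding c_def
    by (simp add: powr_minus powr_divide K powr_mult powr_powr field_simps)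
  finally have "J \<le> ennreal (c powr - r / 2)" using j by (simp add: ennreal_leI)
  then obtain E where E: "E \<in> sets borel" "E \<subseteq> R" "emeasure lborel R \<le> 2 * emeasure lborel E" "\<And>y. y \<in> E \<Longrightarrow> c \<le> v y"
    using large_set_of_negative_moment[OF R(2,4) v vpos r cpos] unfolding J_def by blast
  have "a \<le> K * v y" if "y \<in> E" for y
    using E(4)[OF that] Kpos by (simp add: c_def field_simps)
  then show ?thesis using E(1-3) unfolding a_def v_def by blast
qed


section \<open>The square function estimate\<close>

lemma countable_infsum_ennreal_SUP:
  assumes "countable A"
  obtains S :: "nat \<Rightarrow> 'a set" where "\<And>n. finite (S n)" "\<And>n. S n \<subseteq> A" "incseq S"
    "\<And>f :: 'a \<Rightarrow> ennreal. infsum f A = (SUP n. sum f (S n))"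
proof -
  define S where "S = (\<lambda>n. {a\<in>A. to_nat_on A a < n})"
  have fin: "finite (S n)" for n
  proof (rule finite_imageD)
    show "finite (to_nat_on A ` S n)"
      by (rule finite_subset[of _ "{..<n}"]) (auto simp: S_def)
    show "inj_on (to_nat_on A) (S n)"
      using inj_on_to_nat_on[OF assms] by (rule inj_on_subset) (auto simp: S_def)
  qed
  have sub: "S n \<subseteq> A" for n by (auto simp: S_def)
  have inc: "incseq S" by (auto simp: incseq_def S_def)
  have "infsum f A = (SUP n. sum f (S n))" for f :: "'a \<Rightarrow> ennreal"
  proof -
    have "infsum f A = (SUP F\<in>{F. finite F \<and> F \<subseteq> A}. sum f F)"
      by (rule nonneg_infsum_complete) simp
    also have "\<dots> = (SUP n. sum f (S n))"
    proof (rule antisym)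
      show "(SUP F\<in>{F. finite F \<and> F \<subseteq> A}. sum f F) \<le> (SUP n. sum f (S n))"
      proof (rule SUP_least)
        fix F assume "F \<in> {F. finite F \<and> F \<subseteq> A}"
        then have F: "finite F" "F \<subseteq> A" by auto
        define n where "n = Suc (Max (insert 0 (to_nat_on A ` F)))"
        have "F \<subseteq> S n"
        proof
          fix a assume a: "a \<in> F"
          then have "to_nat_on A a \<le> Max (insert 0 (to_nat_on A ` F))"
            using F(1) by (intro Max_ge) auto
          then show "a \<in> S n" using a F(2) by (auto simp: S_def n_def)
        qed
        then have "sum f F \<le> sum f (S n)" using fin by (intro sum_mono2) auto
        also have "\<dots> \<le> (SUP n. sum f (S n))" by (rule SUP_upper) simp
        finally show "sum f F \<le> (SUP n. sum f (S n))" .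
      qed
      show "(SUP n. sum f (S n)) \<le> (SUP F\<in>{F. finite F \<and> F \<subseteq> A}. sum f F)"
        using fin sub by (intro SUP_mono) blast
    qed
    finally show ?thesis .
  qed
  then show thesis using fin sub inc by (intro that[of S])
qed

lemma finite_signatures: "finite (signatures :: ('n::finite \<Rightarrow> nat) set)"
proof (rule finite_subset)
  show "(signatures :: ('n \<Rightarrow> nat) set) \<subseteq> (\<Pi>\<^sub>E i\<in>UNIV. {0, 1})"
    unfolding signatures_def PiE_UNIV_domain Pi_def by blast
qed (intro finite_PiE, auto)

text \<open>The factor is moved to the side of the measurable function \<open>G\<close> before integrating, so that \<open>H\<close> enters only
  through monotonicity.\<close>

lemma nn_integral_powr_le_scaled:
  assumes t: "0 < t" and k: "0 \<le> k" and G [measurable]: "G \<in> borel_measurable M"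
    and le: "\<And>x. G x \<le> ennreal k * H x"
  shows "(\<integral>\<^sup>+x. ennreal_powr (G x) t \<partial>M) \<le> ennreal (k powr t) * (\<integral>\<^sup>+x. ennreal_powr (H x) t \<partial>M)"
proof (cases "k = 0")
  case True
  then have "G x = 0" for x using le[of x] by simp
  then show ?thesis by simp
next
  case False
  then have k: "0 < k" using k by simp
  have "ennreal (1 / k) * G x \<le> H x" for x
  proof -
    have "ennreal (1 / k) * G x \<le> ennreal (1 / k) * (ennreal k * H x)"
      using le by (rule mult_left_mono) simp
    also have "\<dots> = H x" using k by (simp add: mult.assoc[symmetric] ennreal_mult[symmetric])
    finally show ?thesis .
  qed
  then have "ennreal_powr (ennreal (1 / k) * G x) t \<le> ennreal_powr (H x) t" for x
    using t by (intro ennreal_powr_mono) auto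
  then have "(\<integral>\<^sup>+x. ennreal ((1 / k) powr t) * ennreal_powr (G x) t \<partial>M) \<le> (\<integral>\<^sup>+x. ennreal_powr (H x) t \<partial>M)"
    using t k by (intro nn_integral_mono) (simp add: ennreal_powr_mult)
  then have *: "ennreal ((1 / k) powr t) * (\<integral>\<^sup>+x. ennreal_powr (G x) t \<partial>M) \<le> (\<integral>\<^sup>+x. ennreal_powr (H x) t \<partial>M)"
    by (simp add: nn_integral_cmult)
  have "(\<integral>\<^sup>+x. ennreal_powr (G x) t \<partial>M)
      = ennreal (k powr t) * (ennreal ((1 / k) powr t) * (\<integral>\<^sup>+x. ennreal_powr (G x) t \<partial>M))"
    using k by (simp add: mult.assoc[symmetric] ennreal_mult[symmetric] powr_mult[symmetric])
  also have "\<dots> \<le> ennreal (k powr t) * (\<integral>\<^sup>+x. ennreal_powr (H x) t \<partial>M)"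
    using * by (rule mult_left_mono) simp
  finally show ?thesis .
qed

text \<open>The square of \<open>square_function\<close>; sums can be compared termwise without the outer root.\<close>

definition square_sum ::
  "(((real^'n::finite) \<times> (real^'m::finite)) set \<Rightarrow> (real^'n) \<times> (real^'m) \<Rightarrow> complex^'d^'d::finite)
     \<Rightarrow> ((real^'n) \<times> (real^'m)) set set \<Rightarrow> ((real^'n) \<times> (real^'m) \<Rightarrow> complex^'d)
     \<Rightarrow> (real^'n) \<times> (real^'m) \<Rightarrow> ennreal" where
  "square_sum A \<D> f x = (\<Sum>\<^sub>\<infinity>R\<in>\<D>. \<Sum>\<epsilon>\<in>signatures \<times> signatures.
     ennreal ((norm (A R x *v haar_coeff f R \<epsilon>))\<^sup>2 * indicator R x / measure lebesgue R))"

lemma Lp_norm_square_function: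
  "Lp_norm p (square_function A \<D> f)
    = ennreal_powr (\<integral>\<^sup>+x. ennreal_powr (square_sum A \<D> f x) (p / 2) \<partial>lborel) (1 / p)"
  unfolding Lp_norm_def square_function_def nn_integral_completion square_sum_def[symmetric]
  by (simp add: ennreal_powr_powr)

text \<open>Rectangles and signatures together index the sum, each with its own large subset. The comparison is made
  for finite subfamilies, with a constant that does not depend on them.\<close>

lemma square_sum_estimate:
  fixes f :: "(real^'n::finite) \<times> (real^'m::finite) \<Rightarrow> complex^'d::finite"
  assumes t: "0 < t" and \<D>: "dyadic_cube_grid \<D>1" "dyadic_cube_grid \<D>2" and k: "0 \<le> k"
    and E: "\<And>R e. R \<in> product_grid \<D>1 \<D>2 \<Longrightarrow> \<exists>E\<in>sets borel. E \<subseteq> R \<and>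
      emeasure lborel R \<le> 2 * emeasure lborel E \<and> (\<forall>y\<in>E. norm (\<W> R *v e) \<le> k * norm (V y *v e))"
  shows "(\<integral>\<^sup>+x. ennreal_powr (square_sum (\<lambda>R x. \<W> R) (product_grid \<D>1 \<D>2) f x) t \<partial>lborel)
    \<le> ennreal (shrink_const t * k powr (2 * t))
      * (\<integral>\<^sup>+x. ennreal_powr (square_sum (\<lambda>R x. V x) (product_grid \<D>1 \<D>2) f x) t \<partial>lborel)"
proof -
  let ?\<D> = "product_grid \<D>1 \<D>2" and ?\<Sigma> = "signatures \<times> signatures :: (('n \<Rightarrow> nat) \<times> ('m \<Rightarrow> nat)) set"
  have fin\<Sigma>: "finite ?\<Sigma>" by (intro finite_cartesian_product finite_signatures)
  define E where "E = (\<lambda>i. SOME E. E \<in> sets borel \<and> E \<subseteq> fst i \<and> emeasure lborel (fst i) \<le> 2 * emeasure lborel E \<and>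
      (\<forall>y\<in>E. norm (\<W> (fst i) *v haar_coeff f (fst i) (snd i)) \<le> k * norm (V y *v haar_coeff f (fst i) (snd i))))"
  have E: "E i \<in> sets borel \<and> E i \<subseteq> fst i \<and> emeasure lborel (fst i) \<le> 2 * emeasure lborel (E i) \<and>
      (\<forall>y\<in>E i. norm (\<W> (fst i) *v haar_coeff f (fst i) (snd i)) \<le> k * norm (V y *v haar_coeff f (fst i) (snd i)))"
    if "fst i \<in> ?\<D>" for i
    unfolding E_def by (rule someI_ex) (use assms(5)[OF that] in blast)
  define b where "b = (\<lambda>i. (norm (\<W> (fst i) *v haar_coeff f (fst i) (snd i)))\<^sup>2 / measure lebesgue (fst i))"
  have b: "0 \<le> b i" for i by (simp add: b_def)
  define H where "H = square_sum (\<lambda>R x. V x) ?\<D> f"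
  define T where "T = (\<lambda>S. weighted_count b fst (S \<times> ?\<Sigma>))"
  have borel: "R \<in> sets lborel" if "R \<in> ?\<D>" for R
    using averaging_family_product_grid[OF \<D>, of "{R}"] that by (simp add: averaging_family_def)
  have step: "(\<integral>\<^sup>+x. ennreal_powr (T S x) t \<partial>lborel)
      \<le> ennreal (shrink_const t * k powr (2 * t)) * (\<integral>\<^sup>+x. ennreal_powr (H x) t \<partial>lborel)"
    if S: "finite S" "S \<subseteq> ?\<D>" for S
  proof -
    have SD: "fst i \<in> ?\<D>" if "i \<in> S \<times> ?\<Sigma>" for i using that S(2) by auto
    define G where "G = weighted_count b E (S \<times> ?\<Sigma>)"
    have [measurable]: "G \<in> borel_measurable lborel"
      unfolding G_def using E SD by (intro measurable_weighted_count) auto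
    have GH: "G x \<le> ennreal (k\<^sup>2) * H x" for x
    proof -
      have "G x = (\<Sum>R\<in>S. \<Sum>\<epsilon>\<in>?\<Sigma>. ennreal (b (R, \<epsilon>)) * indicator (E (R, \<epsilon>)) x)"
        unfolding G_def weighted_count_def by (simp add: sum.cartesian_product case_prod_beta)
      also have "\<dots> \<le> (\<Sum>R\<in>S. \<Sum>\<epsilon>\<in>?\<Sigma>. ennreal (k\<^sup>2) *
          ennreal ((norm (V x *v haar_coeff f R \<epsilon>))\<^sup>2 * indicator R x / measure lebesgue R))"
      proof (intro sum_mono)
        fix R \<epsilon> assume R: "R \<in> S" "\<epsilon> \<in> ?\<Sigma>"
        show "ennreal (b (R, \<epsilon>)) * indicator (E (R, \<epsilon>)) x \<le> ennreal (k\<^sup>2) *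
          ennreal ((norm (V x *v haar_coeff f R \<epsilon>))\<^sup>2 * indicator R x / measure lebesgue R)"
        proof (cases "x \<in> E (R, \<epsilon>)")
          case True
          then have "x \<in> R" and le: "norm (\<W> R *v haar_coeff f R \<epsilon>) \<le> k * norm (V x *v haar_coeff f R \<epsilon>)"
            using E[of "(R, \<epsilon>)"] SD[of "(R, \<epsilon>)"] R by auto
          have "(norm (\<W> R *v haar_coeff f R \<epsilon>))\<^sup>2 \<le> (k * norm (V x *v haar_coeff f R \<epsilon>))\<^sup>2"
            using le by (rule power_mono) simp
          then have "b (R, \<epsilon>) \<le> k\<^sup>2 * ((norm (V x *v haar_coeff f R \<epsilon>))\<^sup>2 / measure lebesgue R)"
            unfolding b_def by (simp add: power_mult_distrib divide_right_mono)
          then show ?thesis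
            using True \<open>x \<in> R\<close> by (simp add: ennreal_mult[symmetric] ennreal_leI)
        qed simp
      qed
      also have "\<dots> = ennreal (k\<^sup>2) * (\<Sum>R\<in>S. \<Sum>\<epsilon>\<in>?\<Sigma>.
          ennreal ((norm (V x *v haar_coeff f R \<epsilon>))\<^sup>2 * indicator R x / measure lebesgue R))"
        by (simp only: sum_distrib_left)
      also have "\<dots> \<le> ennreal (k\<^sup>2) * H x"
        unfolding H_def square_sum_def
        by (subst nonneg_infsum_complete, simp, intro mult_left_mono SUP_upper) (use S in auto)
      finally show ?thesis .
    qed
    have "(\<integral>\<^sup>+x. ennreal_powr (T S x) t \<partial>lborel) \<le> ennreal (shrink_const t) * (\<integral>\<^sup>+x. ennreal_powr (G x) t \<partial>lborel)"
      unfolding T_def G_def using S fin\<Sigma> E SD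
      by (intro shrink_rectangles[OF t \<D>] b) auto
    also have "\<dots> \<le> ennreal (shrink_const t) * (ennreal ((k\<^sup>2) powr t) * (\<integral>\<^sup>+x. ennreal_powr (H x) t \<partial>lborel))"
      using t k GH by (intro mult_left_mono nn_integral_powr_le_scaled) auto
    also have "(k\<^sup>2) powr t = k powr (2 * t)"
      using k by (simp add: powr_powr powr_numeral[symmetric] del: powr_numeral)
    finally show ?thesis by (simp add: ennreal_mult'' mult.assoc)
  qed
  obtain S where S: "\<And>n. finite (S n)" "\<And>n. S n \<subseteq> ?\<D>" "incseq S"
    and sup: "\<And>g :: _ \<Rightarrow> ennreal. infsum g ?\<D> = (SUP n. sum g (S n))"
    using countable_infsum_ennreal_SUP[OF countable_product_grid[OF \<D>]] by blast
  have T: "T (S n) x = (\<Sum>R\<in>S n. \<Sum>\<epsilon>\<in>?\<Sigma>.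
      ennreal ((norm (\<W> R *v haar_coeff f R \<epsilon>))\<^sup>2 * indicator R x / measure lebesgue R))" for n x
    unfolding T_def weighted_count_def b_def
    by (simp only: sum.cartesian_product) (intro sum.cong refl, auto simp: indicator_def)
  have "square_sum (\<lambda>R x. \<W> R) ?\<D> f x = (SUP n. T (S n) x)" for x
    unfolding square_sum_def sup T ..
  then have "(\<integral>\<^sup>+x. ennreal_powr (square_sum (\<lambda>R x. \<W> R) ?\<D> f x) t \<partial>lborel)
      = (\<integral>\<^sup>+x. (SUP n. ennreal_powr (T (S n) x) t) \<partial>lborel)"
    using t by (simp add: ennreal_powr_SUP)
  also have "\<dots> = (SUP n. \<integral>\<^sup>+x. ennreal_powr (T (S n) x) t \<partial>lborel)"
  proof (rule nn_integral_monotone_convergence_SUP)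
    show "incseq (\<lambda>n x. ennreal_powr (T (S n) x) t)"
    proof (rule incseq_SucI, rule le_funI, rule ennreal_powr_mono)
      fix n x
      show "T (S n) x \<le> T (S (Suc n)) x"
        unfolding T using S by (intro sum_mono2) (auto dest: incseq_SucD)
    qed (use t in simp)
    show "(\<lambda>x. ennreal_powr (T (S n) x) t) \<in> borel_measurable lborel" for n
      unfolding T_def using S(2)[of n] by (intro measurable_ennreal_powr measurable_weighted_count borel) auto
  qed
  also have "\<dots> \<le> ennreal (shrink_const t * k powr (2 * t)) * (\<integral>\<^sup>+x. ennreal_powr (H x) t \<partial>lborel)"
    using step S by (intro SUP_least) auto
  finally show ?thesis unfolding H_def .
qed

theorem lemma5p3:
  fixes p :: real
  assumes "1 < p"
  shows "\<exists>C :: real.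
    \<forall>(\<D>1 :: (real^'n::finite) set set) (\<D>2 :: (real^'m::finite) set set)
      (W :: (real^'n) \<times> (real^'m) \<Rightarrow> complex^'d^'d::finite)
      (\<W> :: ((real^'n) \<times> (real^'m)) set \<Rightarrow> complex^'d^'d)
      (f :: (real^'n) \<times> (real^'m) \<Rightarrow> complex^'d).
      dyadic_cube_grid \<D>1 \<longrightarrow> dyadic_cube_grid \<D>2 \<longrightarrow>
      Ap_weight p (product_grid \<D>1 \<D>2) W \<longrightarrow>
      (\<forall>R\<in>product_grid \<D>1 \<D>2. reducing_operator p W R (\<W> R)) \<longrightarrow>
      locally_integrable f \<longrightarrow>
      Lp_norm p (reduced_square_function (product_grid \<D>1 \<D>2) \<W> f)
        \<le> ennreal C * ennreal_powr (Ap_constant p (product_grid \<D>1 \<D>2) W) (1 / p)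
            * Lp_norm p (weighted_square_function p (product_grid \<D>1 \<D>2) W f)"
proof -
  define c where "c = 2 powr (1 / conj_exponent p) * sqrt (real CARD('d))"
  have c: "0 < c" by (simp add: c_def)
  show ?thesis
  proof (intro exI[of _ "shrink_const (p / 2) powr (1 / p) * c"] allI impI)
    fix \<D>1 :: "(real^'n) set set" and \<D>2 :: "(real^'m) set set"
      and W :: "(real^'n) \<times> (real^'m) \<Rightarrow> complex^'d^'d"
      and \<W> :: "((real^'n) \<times> (real^'m)) set \<Rightarrow> complex^'d^'d"
      and f :: "(real^'n) \<times> (real^'m) \<Rightarrow> complex^'d"
    let ?\<D> = "product_grid \<D>1 \<D>2"
    assume \<D>: "dyadic_cube_grid \<D>1" "dyadic_cube_grid \<D>2" and W: "Ap_weight p ?\<D> W"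
      and \<W>: "\<forall>R\<in>?\<D>. reducing_operator p W R (\<W> R)"
    define w where "w = enn2real (Ap_constant p ?\<D> W)"
    have w: "Ap_constant p ?\<D> W = ennreal w" "0 \<le> w"
      using W by (auto simp: w_def Ap_weight_def)
    define X where "X = (\<integral>\<^sup>+x. ennreal_powr (square_sum (\<lambda>R x. \<W> R) ?\<D> f x) (p / 2) \<partial>lborel)"
    define Y where "Y = (\<integral>\<^sup>+x. ennreal_powr (square_sum (\<lambda>R x. matrix_powr (W x) (1 / p)) ?\<D> f x) (p / 2) \<partial>lborel)"
    have large: "\<exists>E\<in>sets borel. E \<subseteq> R \<and> emeasure lborel R \<le> 2 * emeasure lborel E \<and>
        (\<forall>y\<in>E. norm (\<W> R *v e) \<le> c * w powr (1 / p) * norm (matrix_powr (W y) (1 / p) *v e))"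
      if "R \<in> ?\<D>" for R e
      using reducing_operator_le_on_large_set[OF assms W that] averaging_family_product_grid[OF \<D>, of "{R}"] \<W> that
      unfolding averaging_family_def c_def w_def by auto
    have "X \<le> ennreal (shrink_const (p / 2) * (c * w powr (1 / p)) powr p) * Y"
      unfolding X_def Y_def using square_sum_estimate[OF _ \<D> _ large, of "p / 2" f] assms c by simp
    then have "ennreal_powr X (1 / p)
        \<le> ennreal_powr (ennreal (shrink_const (p / 2) * (c * w powr (1 / p)) powr p) * Y) (1 / p)"
      using assms by (intro ennreal_powr_mono) auto
    also have "\<dots> = ennreal (shrink_const (p / 2) powr (1 / p) * c) * ennreal (w powr (1 / p)) * ennreal_powr Y (1 / p)"
    proof -
      have "0 \<le> shrink_const (p / 2)" by (simp add: shrink_const_def)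
      then show ?thesis using assms c w
        by (simp add: ennreal_powr_mult powr_mult powr_powr ennreal_mult[symmetric] mult.assoc)
    qed
    finally show "Lp_norm p (reduced_square_function ?\<D> \<W> f)
        \<le> ennreal (shrink_const (p / 2) powr (1 / p) * c) * ennreal_powr (Ap_constant p ?\<D> W) (1 / p)
          * Lp_norm p (weighted_square_function p ?\<D> W f)"
      unfolding reduced_square_function_def weighted_square_function_def Lp_norm_square_function X_def Y_def
      using w by simp
  qed
qed

end
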